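(* Let $\varphi$ be a function of $\ell$ and let $w\in(0,\infty)^\ell$. Suppose that for every cache size $k$ there is a $\varphi(\ell)$-competitive randomized algorithm for weighted interleaved myopic paging (WIMP) with $\ell$ weight classes of weights $w_1,\dots,w_\ell$. Then there is an $O(\varphi(\ell))$-competitive online algorithm for the strict allocation problem in dimension $\ell$ with weights $w$ (the constant in $O(\cdot)$ being absolute).
   Context: Allocation problem in dimension $\ell$ with weights $w$: an algorithm maintains $x(t)\in\Delta^{\ell-1}=\{x\in[0,1]^\ell:\sum_i x_i=1\}$. At each time $t=1,2,\dots$ a direction $r_t\in\{1,\dots,\ell\}$ and a non-increasing $f_t:[0,1]\to\mathbb{R}_{\ge 0}\cup\{\infty\}$ are revealed; the algorithm moves from $x(t-1)$ to $x(t)$ knowing only data revealed so far, paying $\sum_i w_i|x_i(t)-x_i(t-1)|+f_t(x_{r_t}(t))$. In the strict allocation problem each $f_t$ is a strict threshold: for some $c_t\in[0,1]$, $f_t(z)=\infty$ if $z<c_t$ and $f_t(z)=0$ otherwise (so the algorithm must ensure $x_{r_t}(t)\ge c_t$). Weighted paging: pages with weights, cache size $k$, requested page must be in cache after each request, loading page $p$ costs $w_p$; weight class $j$ consists of pages of weight $w_j$, and each class contains arbitrarily many pages. WIMP: when serving request $t$, the algorithm knows the past requests and, for each pair of pages in the same weight class, which is requested next earlier, and nothing else about the future. Competitive ratio $\rho$: (expected) cost at most $\rho\cdot\mathrm{OPT}+b$ for some $b$ independent of the request sequence. *)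

theory Defs
  imports "HOL-Probability.Probability"
begin

text \<open>A page is a pair (j, n): j is its weight class (j < l), n distinguishes pages
  within a class, so every class has infinitely many pages. Page (j,n) has weight w j.
  Requests are a finite list; request number t (t = 1..length) is the list element t-1.\<close>

type_synonym page = "nat \<times> nat"

definition valid_paging_seq :: "nat \<Rightarrow> page list \<Rightarrow> bool" where
  "valid_paging_seq l \<sigma> = (\<forall>p\<in>set \<sigma>. fst p < l)"

text \<open>Time of the next request of page p strictly after time t (infinity if none),
  measured as a 0-based list position.\<close>
definition next_req :: "'a list \<Rightarrow> nat \<Rightarrow> 'a \<Rightarrow> enat" where
  "next_req \<sigma> t p =
     (if \<exists>s. t \<le> s \<and> s < length \<sigma> \<and> \<sigma> ! s = p
      then enat (LEAST s. t \<le> s \<and> s < length \<sigma> \<and> \<sigma> ! s = p) else \<infinity>)"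

definition wimp_info :: "page list \<Rightarrow> nat \<Rightarrow> page \<Rightarrow> page \<Rightarrow> bool" where
  "wimp_info \<sigma> t p q = (fst p = fst q \<and> next_req \<sigma> t p < next_req \<sigma> t q)"

text \<open>A deterministic WIMP policy maps (past requests incl. current one, WIMP info)
  to the cache content after serving the current request.\<close>
type_synonym wimp_policy = "page list \<Rightarrow> (page \<Rightarrow> page \<Rightarrow> bool) \<Rightarrow> page set"

definition wimp_run :: "wimp_policy \<Rightarrow> page list \<Rightarrow> nat \<Rightarrow> page set" where
  "wimp_run A \<sigma> t = (if t = 0 then {} else A (take t \<sigma>) (wimp_info \<sigma> t))"

definition paging_cost :: "(nat \<Rightarrow> real) \<Rightarrow> nat \<Rightarrow> page list \<Rightarrow> (nat \<Rightarrow> page set) \<Rightarrow> ennreal" where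
  "paging_cost w k \<sigma> C =
     (if \<forall>t\<in>{1..length \<sigma>}. finite (C t) \<and> card (C t) \<le> k \<and> \<sigma> ! (t - 1) \<in> C t
      then (\<Sum>t\<in>{1..length \<sigma>}. \<Sum>p\<in>C t - C (t - 1). ennreal (w (fst p)))
      else \<infinity>)"

definition paging_opt :: "(nat \<Rightarrow> real) \<Rightarrow> nat \<Rightarrow> page list \<Rightarrow> ennreal" where
  "paging_opt w k \<sigma> = (INF C \<in> {C. C 0 = {}}. paging_cost w k \<sigma> C)"

definition wimp_competitive :: "nat \<Rightarrow> (nat \<Rightarrow> real) \<Rightarrow> nat \<Rightarrow> real \<Rightarrow> bool" where
  "wimp_competitive l w k \<rho> =
     (\<exists>(M :: wimp_policy measure) (b :: real). prob_space M \<and>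
        (\<forall>\<sigma>. valid_paging_seq l \<sigma> \<longrightarrow>
           (\<lambda>A. paging_cost w k \<sigma> (wimp_run A \<sigma>)) \<in> borel_measurable M \<and>
           (\<integral>\<^sup>+ A. paging_cost w k \<sigma> (wimp_run A \<sigma>) \<partial>M)
              \<le> ennreal \<rho> * paging_opt w k \<sigma> + ennreal b))"

definition prob_simplex :: "nat \<Rightarrow> (nat \<Rightarrow> real) set" where
  "prob_simplex l = {x. (\<forall>i<l. 0 \<le> x i) \<and> (\<Sum>i<l. x i) = 1}"

text \<open>A strict request (r, c) demands x_r \<ge> c.\<close>
definition valid_alloc_seq :: "nat \<Rightarrow> (nat \<times> real) list \<Rightarrow> bool" where
  "valid_alloc_seq l \<sigma> = (\<forall>(r, c)\<in>set \<sigma>. r < l \<and> 0 \<le> c \<and> c \<le> 1)"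

definition alloc_cost :: "nat \<Rightarrow> (nat \<Rightarrow> real) \<Rightarrow> (nat \<times> real) list \<Rightarrow> (nat \<Rightarrow> nat \<Rightarrow> real) \<Rightarrow> ennreal" where
  "alloc_cost l w \<sigma> x =
     (if (\<forall>t\<le>length \<sigma>. x t \<in> prob_simplex l) \<and>
         (\<forall>t\<in>{1..length \<sigma>}. x t (fst (\<sigma> ! (t - 1))) \<ge> snd (\<sigma> ! (t - 1)))
      then ennreal (\<Sum>t\<in>{1..length \<sigma>}. \<Sum>i<l. w i * \<bar>x t i - x (t - 1) i\<bar>)
      else \<infinity>)"

definition alloc_opt :: "nat \<Rightarrow> (nat \<Rightarrow> real) \<Rightarrow> (nat \<times> real) list \<Rightarrow> ennreal" where
  "alloc_opt l w \<sigma> = (INF x. alloc_cost l w \<sigma> x)"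

text \<open>An online allocation algorithm maps the requests revealed so far to the current
  point; x(t) = X (first t requests).\<close>
type_synonym alloc_alg = "(nat \<times> real) list \<Rightarrow> (nat \<Rightarrow> real)"

definition alloc_competitive :: "nat \<Rightarrow> (nat \<Rightarrow> real) \<Rightarrow> alloc_alg \<Rightarrow> real \<Rightarrow> bool" where
  "alloc_competitive l w X \<rho> =
     (\<exists>b :: real. \<forall>\<sigma>. valid_alloc_seq l \<sigma> \<longrightarrow>
        alloc_cost l w \<sigma> (\<lambda>t. X (take t \<sigma>)) \<le> ennreal \<rho> * alloc_opt l w \<sigma> + ennreal b)"

end

theory Submission
  imports Defs
begin

text \<open>An allocation request \<open>(r, c)\<close> is simulated by scanning the first \<open>\<lfloor>k c\<rfloor>\<close> pages of class \<open>r\<close> again and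
  again, always in the same order. Then the order of next requests within a class is known in advance,
  so the WIMP information reveals nothing about future allocation requests, and the expected fraction of
  the cache that each class occupies is an online fractional allocation. Scanning until a repetition
  is cheap for the paging algorithm forces the threshold up to a small error, at no cost for the
  optimum. The additive constant of the paging algorithm, which may depend on \<open>k\<close>, is eliminated by
  starting from a history where the excess of the algorithm over \<open>\<rho> \<cdot> OPT\<close> is almost maximal.
  For each bound on the length of the request sequence and each error this gives an algorithm that is
  correct up to the error, with uniform constants; compactness of the space of algorithms
  (Tychonoff) yields an exact one.\<close>

section \<open>Scans and cache schedules\<close>

text \<open>One page stands for a fraction \<open>1 / k\<close> of the cache, so paging bounds are
  divided by \<open>k\<close>. Rounding an offline allocation to whole pages costs up to one page
  per class and request, and rounding a threshold loses up to \<open>1 / k\<close>. Hence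
  \<open>k\<close> has to grow with the number of requests and with the accuracy, while nothing
  limits the growth of the additive constant of the paging algorithm in \<open>k\<close>: dividing
  by \<open>k\<close> does not tame it. Starting from a nearly extremal history leaves an excess of
  at most 1 for every \<open>k\<close>, and the start itself is free because the initial point of an
  allocation is not charged. Since thresholds are real numbers, there are uncountably many
  histories, so a diagonal subsequence would not reach all of them; this is why the limit is taken
  in a product space.\<close>

definition scan :: "nat \<times> nat \<Rightarrow> page list" where
  "scan x = map (Pair (fst x)) [0..<snd x]"

definition scans :: "(nat \<times> nat) list \<Rightarrow> page list" where
  "scans s = concat (map scan s)"

definition sweep :: "nat \<Rightarrow> nat \<Rightarrow> (nat \<times> nat) list" where
  "sweep l k = map (\<lambda>i. (i, k)) [0..<l]"

lemma scans_simps [simp]: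
  "scans [] = []" "scans (x # s) = scan x @ scans s" "scans (s @ u) = scans s @ scans u"
  by (auto simp: scans_def)

lemma set_scan: "set (scan x) = {fst x} \<times> {..<snd x}"
  by (auto simp: scan_def)

lemma set_sweep: "set (sweep l k) = {..<l} \<times> {k}"
  by (auto simp: sweep_def)

lemma set_scans: "set (scans s) = (\<Union>x\<in>set s. {fst x} \<times> {..<snd x})"
  by (auto simp: scans_def set_scan)

text \<open>Next request times compared on the list of remaining requests: an absent
  \<open>q\<close> counts as infinitely late, an absent \<open>p\<close> gives \<open>False\<close>.
  In this form the comparison can be computed scan by scan.\<close>

fun precedes :: "'a list \<Rightarrow> 'a \<Rightarrow> 'a \<Rightarrow> bool" where
  "precedes [] p q = False"
| "precedes (x # xs) p q = (x \<noteq> q \<and> (x = p \<or> precedes xs p q))"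

lemma precedes_imp_mem: "precedes xs p q \<Longrightarrow> p \<in> set xs"
  by (induction xs) auto

lemma precedes_append:
  "precedes (xs @ ys) p q \<longleftrightarrow>
     precedes xs p q \<or> p \<notin> set xs \<and> q \<notin> set xs \<and> precedes ys p q"
  by (induction xs) (auto dest: precedes_imp_mem)

lemma precedes_upt:
  "precedes (map (Pair r) [j..<m]) (i, a) (i, b) \<longleftrightarrow> i = r \<and> j \<le> a \<and> a < m \<and> (b < j \<or> a < b)"
proof (induction "m - j" arbitrary: j)
  case (Suc d)
  then have "[j..<m] = j # [Suc j..<m]"
    by (simp add: upt_rec)
  with Suc show ?case by auto
qed auto

lemma next_req_beyond: "length \<sigma> \<le> t \<Longrightarrow> next_req \<sigma> t p = \<infinity>"
  by (auto simp: next_req_def)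

lemma next_req_step:
  assumes "t < length \<sigma>"
  shows "next_req \<sigma> t p = (if \<sigma> ! t = p then enat t else next_req \<sigma> (Suc t) p)"
proof (cases "\<sigma> ! t = p")
  case True
  have "(LEAST s. t \<le> s \<and> s < length \<sigma> \<and> \<sigma> ! s = p) = t"
    using True assms by (intro Least_equality) auto
  with True assms show ?thesis by (auto simp: next_req_def)
next
  case False
  then have "(t \<le> s \<and> s < length \<sigma> \<and> \<sigma> ! s = p) \<longleftrightarrow> (Suc t \<le> s \<and> s < length \<sigma> \<and> \<sigma> ! s = p)" for s
    by (cases "s = t") auto
  note * = this
  from False show ?thesis unfolding next_req_def * by (simp only: if_False)
qed

lemma next_req_ge: "enat t \<le> next_req \<sigma> t p"
  unfolding next_req_def by (auto intro: LeastI2)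

lemma next_req_less_iff_precedes:
  "next_req \<sigma> t p < next_req \<sigma> t q \<longleftrightarrow> precedes (drop t \<sigma>) p q"
proof (induction "length \<sigma> - t" arbitrary: t)
  case 0
  then show ?case by (simp add: next_req_beyond)
next
  case (Suc d)
  then have t: "t < length \<sigma>" by simp
  have later: "enat t < next_req \<sigma> (Suc t) p" for p
    using next_req_ge[of "Suc t" \<sigma> p] by (cases "next_req \<sigma> (Suc t) p") auto
  have "\<not> next_req \<sigma> (Suc t) p < enat t"
    using later[of p] by (simp add: not_less less_imp_le)
  moreover have "next_req \<sigma> (Suc t) p < next_req \<sigma> (Suc t) q \<longleftrightarrow> precedes (drop (Suc t) \<sigma>) p q"
    using Suc(2) by (intro Suc(1)) simp
  moreover have "drop t \<sigma> = \<sigma> ! t # drop (Suc t) \<sigma>"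
    using t by (simp add: Cons_nth_drop_Suc)
  ultimately show ?case
    using later[of q] unfolding next_req_step[OF t] by auto
qed

text \<open>Every scan covers an initial segment of its class in increasing order. So the first scan
  to reach \<open>a\<close> or \<open>b\<close> meets the smaller one first, however long the scan
  is, and the full scan in \<open>u\<close> ensures that \<open>a\<close> is reached if
  \<open>a < k\<close>. Pages numbered \<open>k\<close> or more are never requested.\<close>

lemma precedes_scans:
  assumes "set u \<subseteq> {..<l} \<times> {..k}" "{..<l} \<times> {k} \<subseteq> set u"
  shows "precedes (scans u) (i, a) (i, b) \<longleftrightarrow> i < l \<and> a < b \<and> a < k"
proof -
  have outside: "(i, a) \<notin> set (scans v)" if "set v \<subseteq> {..<l} \<times> {..k}" "\<not> (i < l \<and> a < k)" for v
    using that by (fastforce simp: set_scans)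
  have "precedes (scans v) (i, a) (i, b) \<longleftrightarrow> a < b"
    if "set v \<subseteq> {..<l} \<times> {..k}" "(i, k) \<in> set v" "i < l" "a < k" for v
    using that
  proof (induction v)
    case (Cons x v)
    obtain r m where x: "x = (r, m)" by (cases x)
    have *: "precedes (scans (x # v)) (i, a) (i, b) \<longleftrightarrow>
      i = r \<and> a < m \<and> a < b \<or> \<not> (i = r \<and> a < m) \<and> \<not> (i = r \<and> b < m) \<and> precedes (scans v) (i, a) (i, b)"
      by (auto simp: x scan_def precedes_append precedes_upt)
    show ?case
    proof (cases "x = (i, k)")
      case True
      with Cons.prems x * show ?thesis by auto
    next
      case False
      with Cons x have "precedes (scans v) (i, a) (i, b) \<longleftrightarrow> a < b" by auto
      with * show ?thesis by auto
    qed
  qed simp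
  note inside = this
  show ?thesis
  proof (cases "i < l \<and> a < k")
    case True
    with inside[OF assms(1)] assms(2) show ?thesis by auto
  next
    case False
    with outside[OF assms(1)] show ?thesis using precedes_imp_mem by metis
  qed
qed

text \<open>The unfinished scan \<open>xs\<close> and the whole scans \<open>v\<close> are chosen
  before \<open>u\<close>, so that two continuations can be compared with the same \<open>xs\<close>
  and \<open>v\<close>.\<close>

lemma drop_scans:
  assumes "t \<le> length (scans s)"
  shows "\<exists>xs v. set v \<subseteq> set s \<and> (\<forall>u. drop t (scans (s @ u)) = xs @ scans (v @ u))"
  using assms
proof (induction s arbitrary: t)
  case Nil
  then show ?case by (intro exI[of _ "[]"]) auto
next
  case (Cons x s)
  show ?case
  proof (cases "t \<le> length (scan x)")
    case True
    then show ?thesis by (intro exI[of _ "drop t (scan x)"] exI[of _ s]) auto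
  next
    case False
    then have "t - length (scan x) \<le> length (scans s)"
      using Cons.prems by simp
    from Cons.IH[OF this] obtain xs v where "set v \<subseteq> set s"
      "\<forall>u. drop (t - length (scan x)) (scans (s @ u)) = xs @ scans (v @ u)"
      by blast
    with False show ?thesis by (intro exI[of _ xs] exI[of _ v]) auto
  qed
qed

text \<open>A scan visits the pages of its class in increasing order, so as long as a full scan of every
  class is still to come, the order of next requests is determined by the past.\<close>
lemma wimp_info_scans:
  assumes s: "set s \<subseteq> {..<l} \<times> {..k}"
    and u: "set u \<subseteq> {..<l} \<times> {..k}" "{..<l} \<times> {k} \<subseteq> set u"
    and u': "set u' \<subseteq> {..<l} \<times> {..k}" "{..<l} \<times> {k} \<subseteq> set u'"
    and t: "t \<le> length (scans s)"
  shows "wimp_info (scans (s @ u)) t = wimp_info (scans (s @ u')) t"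
proof -
  obtain xs v where v: "set v \<subseteq> set s" "\<And>u. drop t (scans (s @ u)) = xs @ scans (v @ u)"
    using drop_scans[OF t] by blast
  have "precedes (scans (v @ u)) (i, a) (i, b) = precedes (scans (v @ u')) (i, a) (i, b)" for i a b
    using v(1) s u u' by (subst (1 2) precedes_scans[of _ l k]) auto
  \<comment> \<open>A pair touched by the common remainder \<open>xs\<close> is decided there; for
    all others both continuations decide by page number.\<close>
  then show ?thesis
    unfolding wimp_info_def next_req_less_iff_precedes v(2)
    by (intro ext) (auto simp: precedes_append simp del: scans_simps)
qed

section \<open>Loading costs of cache schedules and the paging optimum\<close>

definition load_weight :: "(nat \<Rightarrow> real) \<Rightarrow> page set \<Rightarrow> ennreal" where
  "load_weight w S = (\<Sum>p\<in>S. ennreal (w (fst p)))"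

fun loads :: "(nat \<Rightarrow> real) \<Rightarrow> page set \<Rightarrow> page set list \<Rightarrow> ennreal" where
  "loads w K [] = 0"
| "loads w K (S # cs) = load_weight w (S - K) + loads w S cs"

lemma load_weight_mono: "finite T \<Longrightarrow> S \<subseteq> T \<Longrightarrow> load_weight w S \<le> load_weight w T"
  unfolding load_weight_def by (intro sum_mono2) auto

lemma load_weight_empty [simp]: "load_weight w {} = 0"
  by (simp add: load_weight_def)

lemma load_weight_triangle:
  assumes "finite S" "finite T"
  shows "load_weight w (S - K) \<le> load_weight w (T - K) + load_weight w (S - T)"
proof -
  have "load_weight w (S - K) \<le> load_weight w ((T - K) \<union> (S - T))"
    using assms by (intro load_weight_mono) auto
  also have "\<dots> \<le> load_weight w (T - K) + load_weight w (S - T)"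
    unfolding load_weight_def using assms by (subst sum.union_disjoint) auto
  finally show ?thesis .
qed

lemma loads_append: "loads w K (cs @ ds) = loads w K cs + loads w (last (K # cs)) ds"
  by (induction cs arbitrary: K) (auto simp: add.assoc)

text \<open>Only the first load depends on the starting cache, and it obeys a triangle inequality.
  With \<open>T = {}\<close> this says that an empty starting cache is the worst one.\<close>

lemma loads_triangle:
  assumes "finite T" "\<forall>S\<in>set cs. finite S"
  shows "loads w K cs \<le> load_weight w (T - K) + loads w T cs"
proof (cases cs)
  case (Cons S ds)
  with assms have "load_weight w (S - K) \<le> load_weight w (T - K) + load_weight w (S - T)"
    by (intro load_weight_triangle) auto
  from add_right_mono[OF this] show ?thesis by (simp add: Cons add.assoc)
qed simp

lemma load_weight_le_loads:
  assumes "finite K" "\<forall>S\<in>set cs. finite S"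
  shows "load_weight w (last (K # cs) - K) \<le> loads w K cs"
  using assms
proof (induction cs rule: rev_induct)
  case (snoc S cs)
  have "finite (last (K # cs))" using snoc.prems by (auto simp: last_in_set)
  then have "load_weight w (S - K) \<le>
      load_weight w (last (K # cs) - K) + load_weight w (S - last (K # cs))"
    using snoc.prems by (intro load_weight_triangle) auto
  also have "\<dots> \<le> loads w K cs + load_weight w (S - last (K # cs))"
    using snoc by (intro add_right_mono) auto
  finally show ?case by (simp add: loads_append)
qed simp

lemma loads_map_upt:
  "loads w (C 0) (map C [1..<Suc n]) = (\<Sum>t\<in>{1..n}. load_weight w (C t - C (t - 1)))"
proof (induction n)
  case (Suc n)
  have "last (C 0 # map C [1..<Suc n]) = C n" by (cases n) auto
  with Suc show ?case by (simp add: loads_append)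
qed simp

definition serves :: "nat \<Rightarrow> page set list \<Rightarrow> page list \<Rightarrow> bool" where
  "serves k = list_all2 (\<lambda>S p. finite S \<and> card S \<le> k \<and> p \<in> S)"

lemma serves_imp_finite: "serves k cs \<sigma> \<Longrightarrow> S \<in> set cs \<Longrightarrow> finite S"
  by (auto simp: serves_def list_all2_conv_all_nth in_set_conv_nth)

lemma paging_cost_eq:
  "paging_cost w k \<sigma> C =
     (if serves k (map C [1..<Suc (length \<sigma>)]) \<sigma>
      then loads w (C 0) (map C [1..<Suc (length \<sigma>)]) else \<infinity>)"
proof -
  have "(\<forall>t\<in>{1..length \<sigma>}. finite (C t) \<and> card (C t) \<le> k \<and> \<sigma> ! (t - 1) \<in> C t) \<longleftrightarrow>
      (\<forall>t<length \<sigma>. finite (C (Suc t)) \<and> card (C (Suc t)) \<le> k \<and> \<sigma> ! t \<in> C (Suc t))"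
    by (metis Suc_le_eq Suc_pred atLeastAtMost_iff diff_Suc_1 le_numeral_extra(4) less_eq_Suc_le
        One_nat_def zero_less_Suc)
  also have "\<dots> \<longleftrightarrow> serves k (map C [1..<Suc (length \<sigma>)]) \<sigma>"
    by (auto simp: serves_def list_all2_conv_all_nth simp del: upt_Suc)
  finally show ?thesis
    unfolding paging_cost_def loads_map_upt load_weight_def by auto
qed

lemma paging_opt_le_loads:
  assumes "serves k cs \<sigma>"
  shows "paging_opt w k \<sigma> \<le> loads w {} cs"
proof -
  define C where "C t = (if t = 0 then {} else cs ! (t - 1))" for t :: nat
  have "length cs = length \<sigma>" using assms by (simp add: serves_def list_all2_lengthD)
  then have "map C [1..<Suc (length \<sigma>)] = cs"
    by (intro nth_equalityI) (auto simp: C_def simp del: upt_Suc)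
  moreover have "C 0 = {}" by (simp add: C_def)
  ultimately have "paging_cost w k \<sigma> C = loads w {} cs"
    using assms by (simp add: paging_cost_eq)
  with \<open>C 0 = {}\<close> show ?thesis
    unfolding paging_opt_def by (intro INF_lower2[of C]) auto
qed

lemma paging_opt_eq_loads:
  "paging_opt w k \<sigma> = (INF cs\<in>{cs. serves k cs \<sigma>}. loads w {} cs)"
proof (rule antisym)
  show "paging_opt w k \<sigma> \<le> (INF cs\<in>{cs. serves k cs \<sigma>}. loads w {} cs)"
    by (intro INF_greatest paging_opt_le_loads) auto
  show "(INF cs\<in>{cs. serves k cs \<sigma>}. loads w {} cs) \<le> paging_opt w k \<sigma>"
    unfolding paging_opt_def paging_cost_eq
    by (intro INF_greatest) (auto intro: INF_lower2 simp del: upt_Suc)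
qed

text \<open>Near-optimal schedules of the two parts are concatenated; the second one loses nothing
  by starting with a nonempty cache.\<close>

lemma paging_opt_append:
  "paging_opt w k (\<sigma> @ \<tau>) \<le> paging_opt w k \<sigma> + paging_opt w k \<tau>"
proof -
  have *: "paging_opt w k (\<sigma> @ \<tau>) \<le> loads w {} cs + loads w {} ds"
    if "serves k cs \<sigma>" "serves k ds \<tau>" for cs ds
  proof -
    have "finite (last ({} # cs))"
      using serves_imp_finite[OF that(1)] by (auto simp: last_in_set)
    then have "loads w (last ({} # cs)) ds \<le> loads w {} ds"
      using loads_triangle[of "{}" ds w "last ({} # cs)"] serves_imp_finite[OF that(2)] by simp
    moreover have "serves k (cs @ ds) (\<sigma> @ \<tau>)"
      using that unfolding serves_def by (intro list_all2_appendI)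
    ultimately show ?thesis
      using paging_opt_le_loads by (fastforce simp: loads_append intro: order_trans add_left_mono)
  qed
  show ?thesis
  proof (cases "paging_opt w k \<sigma> = \<infinity> \<or> paging_opt w k \<tau> = \<infinity>")
    case False
    show ?thesis
    proof (rule ennreal_le_epsilon)
      fix e :: real
      assume "0 < e"
      with False obtain cs ds
        where "serves k cs \<sigma>" "loads w {} cs < paging_opt w k \<sigma> + ennreal (e / 2)"
          and "serves k ds \<tau>" "loads w {} ds < paging_opt w k \<tau> + ennreal (e / 2)"
        using INF_approx_ennreal[OF _ paging_opt_eq_loads, of "e / 2" w k \<sigma>]
          INF_approx_ennreal[OF _ paging_opt_eq_loads, of "e / 2" w k \<tau>] by auto
      then have "paging_opt w k (\<sigma> @ \<tau>) \<le>
          paging_opt w k \<sigma> + ennreal (e / 2) + (paging_opt w k \<tau> + ennreal (e / 2))"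
        by (intro order_trans[OF *] add_mono) auto
      also have "\<dots> = paging_opt w k \<sigma> + paging_opt w k \<tau> + (ennreal (e / 2) + ennreal (e / 2))"
        by (simp add: ac_simps)
      also have "ennreal (e / 2) + ennreal (e / 2) = ennreal e"
        using \<open>0 < e\<close> by (subst ennreal_plus[symmetric]) auto
      finally show "paging_opt w k (\<sigma> @ \<tau>) \<le> paging_opt w k \<sigma> + paging_opt w k \<tau> + ennreal e" .
    qed
  qed auto
qed

text \<open>The cache \<open>K\<close> is kept for a whole block, so loads occur only between
  blocks. An empty block contributes no cache to the schedule, whence an inequality instead of an
  equation.\<close>

lemma paging_opt_blocks:
  assumes "\<forall>(K, \<sigma>)\<in>set zs. finite K \<and> card K \<le> k \<and> set \<sigma> \<subseteq> K"
  shows "paging_opt w k (concat (map snd zs)) \<le> loads w {} (map fst zs)"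
proof -
  define cs where "cs = concat (map (\<lambda>(K, \<sigma>). replicate (length \<sigma>) K) zs)"
  have "serves k cs (concat (map snd zs))"
    using assms unfolding cs_def
  proof (induction zs)
    case (Cons z zs)
    obtain K \<sigma> where z: "z = (K, \<sigma>)" by (cases z)
    have "serves k (replicate (length \<sigma>) K) \<sigma>"
      using Cons.prems nth_mem[of _ \<sigma>] by (fastforce simp: z serves_def list_all2_conv_all_nth)
    with Cons show ?case by (auto simp: z serves_def intro!: list_all2_appendI)
  qed (simp add: serves_def)
  moreover have "loads w K0 cs \<le> loads w K0 (map fst zs)" for K0
    using assms unfolding cs_def
  proof (induction zs arbitrary: K0)
    case (Cons z zs)
    obtain K \<sigma> where z: "z = (K, \<sigma>)" by (cases z)
    define ds where "ds = concat (map (\<lambda>(K, \<sigma>). replicate (length \<sigma>) K) zs)"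
    have K: "finite K" "\<forall>S\<in>set ds. finite S" using Cons.prems z by (auto simp: ds_def)
    have rep: "loads w K (replicate n K @ ds) = loads w K ds" for n
      by (induction n) auto
    have "loads w K0 (replicate n K @ ds) \<le> load_weight w (K - K0) + loads w K ds" for n
      using loads_triangle[OF K(1), of "replicate n K @ ds" w K0] K unfolding rep by (auto simp: set_replicate_conv_if split: if_splits)
    also have "loads w K ds \<le> loads w K (map fst zs)"
      unfolding ds_def using Cons by auto
    finally show ?case by (auto simp: z ds_def)
  qed simp
  ultimately show ?thesis using paging_opt_le_loads order_trans by blast
qed

section \<open>Expected cache contents\<close>

text \<open>Only the cost functions are known to be measurable, not the cache contents. As they take
  countably many values, finitely many of them cannot distinguish the policies from one
  representative per joint value, and on the representatives everything is measurable.\<close>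
lemma discrete_representatives:
  fixes f :: "'b \<Rightarrow> 'a \<Rightarrow> ennreal"
  assumes "prob_space M" and F: "finite F"
    and meas: "\<And>\<sigma>. \<sigma> \<in> F \<Longrightarrow> f \<sigma> \<in> borel_measurable M"
    and count: "\<And>\<sigma>. \<sigma> \<in> F \<Longrightarrow> countable (range (f \<sigma>))"
    and fin: "\<And>\<sigma>. \<sigma> \<in> F \<Longrightarrow> (\<integral>\<^sup>+ A. f \<sigma> A \<partial>M) < \<infinity>"
  obtains N where "prob_space N" "sets N = Pow (space N)"
    "\<And>\<sigma> A. \<sigma> \<in> F \<Longrightarrow> A \<in> space N \<Longrightarrow> f \<sigma> A < \<infinity>"
    "\<And>\<sigma>. \<sigma> \<in> F \<Longrightarrow> (\<integral>\<^sup>+ A. f \<sigma> A \<partial>N) = (\<integral>\<^sup>+ A. f \<sigma> A \<partial>M)"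
proof -
  interpret prob_space M by fact
  define G where "G = {A \<in> space M. \<forall>\<sigma>\<in>F. f \<sigma> A < \<infinity>}"
  define \<phi> where "\<phi> A = restrict (\<lambda>\<sigma>. f \<sigma> A) F" for A
  have "AE A in M. f \<sigma> A \<noteq> \<infinity>" if "\<sigma> \<in> F" for \<sigma>
    using meas[OF that] fin[OF that] by (intro nn_integral_noteq_infinite) auto
  then have "AE A in M. \<forall>\<sigma>\<in>F. f \<sigma> A < \<infinity>"
    using F by (intro AE_finite_allI) (auto simp: less_top)
  then have aeG: "AE A in M. A \<in> G"
    by (auto simp: G_def)
  then have "G \<noteq> {}"
    using prob_space_axioms by (metis AE_False empty_iff eventually_mono)
  then obtain A0 where A0: "A0 \<in> G" by auto
  have Gm: "G \<in> sets M"
    unfolding G_def using meas F by measurable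
  \<comment> \<open>Policies in \<open>G\<close> with the same costs on \<open>F\<close> get the
    same image. \<open>A0\<close> is a default value outside \<open>G\<close>, that is, on a null
    set.\<close>
  define h where "h A = (if A \<in> G then inv_into G \<phi> (\<phi> A) else A0)" for A
  have hG: "h A \<in> G" for A
    using A0 by (auto simp: h_def intro: inv_into_into)
  have f_h: "f \<sigma> (h A) = f \<sigma> A" if "A \<in> G" "\<sigma> \<in> F" for A \<sigma>
  proof -
    have "\<phi> (h A) = \<phi> A" using that by (auto simp: h_def f_inv_into_f)
    from fun_cong[OF this, of \<sigma>] show ?thesis using that by (simp add: \<phi>_def)
  qed
  have "countable (\<phi> ` G)"
  proof (rule countable_subset)
    show "\<phi> ` G \<subseteq> PiE F (\<lambda>\<sigma>. range (f \<sigma>))" by (auto simp: \<phi>_def)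
    show "countable (PiE F (\<lambda>\<sigma>. range (f \<sigma>)))" using F count by (intro countable_PiE) auto
  qed
  \<comment> \<open>Up to the complement of \<open>G\<close>, every preimage is a countable union of
    measurable fibers. Hence the target may carry the discrete sigma-algebra, for which every
    function is measurable.\<close>
  have h: "h \<in> measurable M (count_space G)"
  proof (rule measurableI)
    fix X assume "X \<in> sets (count_space G)"
    define V where "V = {v \<in> \<phi> ` G. inv_into G \<phi> v \<in> X}"
    have fiber: "{A \<in> G. \<phi> A = v} \<in> sets M" if "v \<in> V" for v
    proof -
      have "{A \<in> G. \<phi> A = v} = {A \<in> space M. A \<in> G \<and> (\<forall>\<sigma>\<in>F. f \<sigma> A = v \<sigma>)}"
        using that by (auto simp: V_def \<phi>_def G_def fun_eq_iff restrict_def)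
      also have "\<dots> \<in> sets M" using meas F Gm by measurable
      finally show ?thesis .
    qed
    have "h -` X \<inter> space M =
        (\<Union>v\<in>V. {A \<in> G. \<phi> A = v}) \<union> (if A0 \<in> X then space M - G else {})"
      by (auto simp: h_def V_def G_def split: if_splits)
    moreover have "countable V"
      using \<open>countable (\<phi> ` G)\<close> by (auto simp: V_def intro: countable_subset)
    then have "(\<Union>v\<in>V. {A \<in> G. \<phi> A = v}) \<in> sets M"
      using fiber by (intro sets.countable_UN') auto
    ultimately show "h -` X \<inter> space M \<in> sets M" using Gm by auto
  qed (use hG in auto)
  define N where "N = distr M (count_space G) h"
  show thesis
  proof
    show "prob_space N" unfolding N_def using h by (rule prob_space_distr)
    show "sets N = Pow (space N)" by (simp add: N_def)
    show "f \<sigma> A < \<infinity>" if "\<sigma> \<in> F" "A \<in> space N" for \<sigma> A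
      using that by (auto simp: N_def G_def)
    show "(\<integral>\<^sup>+ A. f \<sigma> A \<partial>N) = (\<integral>\<^sup>+ A. f \<sigma> A \<partial>M)" if "\<sigma> \<in> F" for \<sigma>
      unfolding N_def using h aeG f_h that
      by (subst nn_integral_distr) (auto intro!: nn_integral_cong_AE)
  qed
qed

lemma loads_finite: "loads w K cs < \<infinity>"
proof (induction cs arbitrary: K)
  case (Cons S cs)
  have "load_weight w (S - K) < \<infinity>"
    unfolding load_weight_def by (cases "finite (S - K)") auto
  with Cons show ?case by simp
qed simp

lemma paging_opt_finite:
  assumes "k \<ge> 1"
  shows "paging_opt w k \<sigma> < \<infinity>"
proof -
  have "serves k (map (\<lambda>p. {p}) \<sigma>) \<sigma>"
    using assms by (auto simp: serves_def list_all2_conv_all_nth)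
  from paging_opt_le_loads[OF this] loads_finite show ?thesis by (rule order.strict_trans1)
qed

text \<open>A finite cost comes from a list of finite page sets, and there are only countably many
  of these.\<close>

lemma countable_range_paging_cost:
  "countable (range (\<lambda>A. paging_cost w k \<sigma> (wimp_run A \<sigma>)))"
proof (rule countable_subset)
  show "range (\<lambda>A. paging_cost w k \<sigma> (wimp_run A \<sigma>)) \<subseteq>
      insert \<infinity> (loads w {} ` lists (Collect finite))"
  proof
    fix z assume "z \<in> range (\<lambda>A. paging_cost w k \<sigma> (wimp_run A \<sigma>))"
    then obtain A where z: "z = paging_cost w k \<sigma> (wimp_run A \<sigma>)" by auto
    have "wimp_run A \<sigma> 0 = {}" by (simp add: wimp_run_def)
    then show "z \<in> insert \<infinity> (loads w {} ` lists (Collect finite))"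
      unfolding z paging_cost_eq by (auto simp del: upt_Suc dest: serves_imp_finite)
  qed
  show "countable (insert \<infinity> (loads w {} ` lists (Collect finite)))"
    by (intro countable_insert countable_image countable_lists countable_Collect_finite)
qed

lemma serves_last:
  assumes "serves k cs \<sigma>"
  shows "finite (last ({} # cs))" "card (last ({} # cs)) \<le> k"
proof -
  have "finite S \<and> card S \<le> k" if "S \<in> set cs" for S
    using assms that by (auto simp: serves_def list_all2_conv_all_nth in_set_conv_nth)
  from this[of "last cs"] show "finite (last ({} # cs))" "card (last ({} # cs)) \<le> k"
    by (cases "cs = []"; simp)+
qed

text \<open>At position \<open>j\<close>, where \<open>p\<close> is served, it must have been
  loaded. Only the first \<open>Suc j\<close> caches are considered, since \<open>p\<close> may be
  evicted later.\<close>

lemma loads_miss: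
  assumes "serves k ds \<sigma>" "p \<in> set \<sigma>" "p \<notin> K" "finite K"
  shows "ennreal (w (fst p)) \<le> loads w K ds"
proof -
  obtain j where j: "j < length \<sigma>" "\<sigma> ! j = p" using assms(2) by (auto simp: in_set_conv_nth)
  then have S: "j < length ds" "finite (ds ! j)" "p \<in> ds ! j"
    using assms(1) by (auto simp: serves_def list_all2_conv_all_nth)
  have "ennreal (w (fst p)) = load_weight w {p}" by (simp add: load_weight_def)
  also have "\<dots> \<le> load_weight w (ds ! j - K)"
    using S assms(3) by (intro load_weight_mono) auto
  also have "\<dots> = load_weight w (last (K # take (Suc j) ds) - K)"
    using S by (simp add: take_Suc_conv_app_nth)
  also have "\<dots> \<le> loads w K (take (Suc j) ds)"
    using assms serves_imp_finite by (intro load_weight_le_loads) (auto dest: in_set_takeD)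
  also have "\<dots> \<le> loads w K (take (Suc j) ds @ drop (Suc j) ds)"
    unfolding loads_append by simp
  finally show ?thesis by simp
qed

section \<open>Pages per weight class and the effect of a single scan\<close>

definition in_class :: "nat \<Rightarrow> page set \<Rightarrow> nat" where
  "in_class i K = card {p \<in> K. fst p = i}"

lemma sum_in_class_le:
  assumes "finite K"
  shows "(\<Sum>i<l. in_class i K) \<le> card K"
proof -
  have "(\<Sum>i<l. in_class i K) = card (\<Union>i<l. {p \<in> K. fst p = i})"
    unfolding in_class_def using assms by (intro card_UN_disjoint[symmetric]) auto
  also have "\<dots> \<le> card K" using assms by (intro card_mono) auto
  finally show ?thesis .
qed

lemma in_class_le:
  assumes "finite K" "finite K'"
  shows "in_class i K' \<le> in_class i K + in_class i (K' - K)"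
proof -
  have "in_class i K' \<le> card ({p \<in> K. fst p = i} \<union> {p \<in> K' - K. fst p = i})"
    unfolding in_class_def using assms by (intro card_mono) auto
  also have "\<dots> \<le> in_class i K + in_class i (K' - K)"
    unfolding in_class_def by (rule card_Un_le)
  finally show ?thesis .
qed

text \<open>An inequality only, because \<open>S\<close> may contain pages of classes from
  \<open>l\<close> on.\<close>

lemma sum_in_class_weight_le:
  fixes w :: "nat \<Rightarrow> real"
  assumes "finite S" "\<forall>i<l. w i > 0"
  shows "ennreal (\<Sum>i<l. w i * in_class i S) \<le> load_weight w S"
proof -
  have "ennreal (\<Sum>i<l. w i * in_class i S) = (\<Sum>i<l. \<Sum>p\<in>{p \<in> S. fst p = i}. ennreal (w (fst p)))"
    using assms by (subst sum_ennreal[symmetric])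
      (auto simp: in_class_def ennreal_mult' ennreal_of_nat_eq_real_of_nat mult.commute less_imp_le intro!: sum.cong)
  also have "\<dots> = (\<Sum>p\<in>(\<Union>i<l. {p \<in> S. fst p = i}). ennreal (w (fst p)))"
    using assms(1) by (intro sum.UNION_disjoint[symmetric]) auto
  also have "\<dots> \<le> load_weight w S"
    unfolding load_weight_def using assms(1) by (intro sum_mono2) auto
  finally show ?thesis .
qed

definition rounds :: "nat \<Rightarrow> nat \<Rightarrow> (nat \<times> nat) list \<Rightarrow> bool" where
  "rounds l k s \<longleftrightarrow> set s \<subseteq> {..<l} \<times> {..k}"

lemma rounds_append [simp]: "rounds l k (s @ u) \<longleftrightarrow> rounds l k s \<and> rounds l k u"
  by (auto simp: rounds_def)

text \<open>The final sweep makes the information available to the policy independent of what follows \<open>s\<close>.\<close>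
definition trajectory :: "nat \<Rightarrow> nat \<Rightarrow> wimp_policy \<Rightarrow> (nat \<times> nat) list \<Rightarrow> page set list" where
  "trajectory l k A s = map (wimp_run A (scans (s @ sweep l k))) [1..<Suc (length (scans s))]"

lemma take_map_upt: "n \<le> N \<Longrightarrow> take n (map f [1..<Suc N]) = map f [1..<Suc n]"
  by (simp add: take_map take_upt del: upt_Suc)

lemma length_trajectory [simp]: "length (trajectory l k A s) = length (scans s)"
  by (simp add: trajectory_def del: upt_Suc)

text \<open>This makes the simulation online: the sweep alone and \<open>u\<close> followed by the
  sweep both contain a full scan of every class, so the policy receives the same information while
  \<open>s\<close> is served.\<close>

lemma trajectory_append:
  assumes "rounds l k s" "rounds l k u"
  shows "trajectory l k A (s @ u) = trajectory l k A s @ drop (length (scans s)) (trajectory l k A (s @ u))"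
proof -
  have "wimp_run A (scans ((s @ u) @ sweep l k)) t = wimp_run A (scans (s @ sweep l k)) t"
    if "t \<le> length (scans s)" for t
  proof -
    have "wimp_info (scans (s @ u @ sweep l k)) t = wimp_info (scans (s @ sweep l k)) t"
      using assms that by (intro wimp_info_scans[of s l k]) (auto simp: rounds_def set_sweep)
    with that show ?thesis by (simp add: wimp_run_def)
  qed
  then have "take (length (scans s)) (trajectory l k A (s @ u)) = trajectory l k A s"
    unfolding trajectory_def
    by (subst take_map_upt) (auto simp del: upt_Suc scans_simps(2) intro!: map_cong)
  then show ?thesis by (metis append_take_drop_id)
qed

lemma trajectory_serves:
  assumes "paging_cost w k (scans (s @ sweep l k)) (wimp_run A (scans (s @ sweep l k))) < \<infinity>"
  shows "serves k (trajectory l k A s) (scans s)"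
    and "loads w {} (trajectory l k A s) \<le> paging_cost w k (scans (s @ sweep l k)) (wimp_run A (scans (s @ sweep l k)))"
proof -
  let ?\<sigma> = "scans (s @ sweep l k)"
  let ?C = "map (wimp_run A ?\<sigma>) [1..<Suc (length ?\<sigma>)]"
  have full: "serves k ?C ?\<sigma>"
    using assms unfolding paging_cost_eq by (auto split: if_splits)
  have take: "take (length (scans s)) ?C = trajectory l k A s"
    unfolding trajectory_def by (subst take_map_upt) auto
  have "serves k (take (length (scans s)) ?C) (take (length (scans s)) ?\<sigma>)"
    using full unfolding serves_def by (rule list_all2_takeI)
  then show "serves k (trajectory l k A s) (scans s)"
    unfolding take by simp
  have "paging_cost w k ?\<sigma> (wimp_run A ?\<sigma>) = loads w {} ?C"
    unfolding paging_cost_eq using full by (simp add: wimp_run_def del: upt_Suc)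
  moreover have "loads w {} (take n ?C) \<le> loads w {} ?C" for n
    by (metis append_take_drop_id loads_append le_iff_add)
  ultimately show "loads w {} (trajectory l k A s) \<le> paging_cost w k ?\<sigma> (wimp_run A ?\<sigma>)"
    by (metis take)
qed

definition cache :: "nat \<Rightarrow> nat \<Rightarrow> wimp_policy \<Rightarrow> (nat \<times> nat) list \<Rightarrow> page set" where
  "cache l k A s = last ({} # trajectory l k A s)"

definition cost :: "(nat \<Rightarrow> real) \<Rightarrow> nat \<Rightarrow> nat \<Rightarrow> wimp_policy \<Rightarrow> (nat \<times> nat) list \<Rightarrow> real" where
  "cost w l k A s = enn2real (loads w {} (trajectory l k A s))"

text \<open>Either all \<open>m\<close> pages of the scan are in \<open>K\<close>, or one of them is
  missing and the scan costs at least \<open>w r\<close>. The last claim merges both cases into one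
  inequality that is linear in the page count and the cost, so that it survives taking expectations;
  the factor \<open>m\<close> is the price.\<close>

lemma policy_step:
  fixes w :: "nat \<Rightarrow> real"
  assumes s: "rounds l k s" "(r, m) \<in> {..<l} \<times> {..k}" and w: "\<forall>i<l. w i > 0"
    and serves: "serves k (trajectory l k A s) (scans s)"
      "serves k (trajectory l k A (s @ [(r, m)])) (scans (s @ [(r, m)]))"
  defines "K \<equiv> cache l k A s" and "K' \<equiv> cache l k A (s @ [(r, m)])"
    and "(\<Delta> :: real) \<equiv> cost w l k A (s @ [(r, m)]) - cost w l k A s"
  shows "finite K" "card K \<le> k" "finite K'"
    and "(\<Sum>i<l. w i * in_class i (K' - K)) \<le> \<Delta>"
    and "w r * m \<le> w r * in_class r K + m * \<Delta>"
proof -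
  define ds where "ds = drop (length (scans s)) (trajectory l k A (s @ [(r, m)]))"
  have tr: "trajectory l k A (s @ [(r, m)]) = trajectory l k A s @ ds"
    unfolding ds_def using s by (intro trajectory_append) (auto simp: rounds_def)
  have ds: "serves k ds (scan (r, m))"
    using list_all2_dropI[OF serves(2)[unfolded serves_def], of "length (scans s)"]
    by (simp add: ds_def serves_def)
  show K: "finite K" "card K \<le> k" "finite K'"
    unfolding K_def K'_def cache_def using serves_last serves by auto
  have K': "K' = last (K # ds)"
    unfolding K_def K'_def cache_def tr by simp
  have "loads w {} (trajectory l k A (s @ [(r, m)])) = loads w {} (trajectory l k A s) + loads w K ds"
    unfolding tr loads_append K_def cache_def by simp
  then have \<Delta>: "\<Delta> = enn2real (loads w K ds)"
    unfolding \<Delta>_def cost_def using loads_finite by (simp add: enn2real_plus)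
  have "ennreal (\<Sum>i<l. w i * in_class i (K' - K)) \<le> load_weight w (K' - K)"
    using K w by (intro sum_in_class_weight_le) auto
  also have "\<dots> \<le> loads w K ds"
    unfolding K' using K ds serves_imp_finite by (intro load_weight_le_loads) auto
  finally show "(\<Sum>i<l. w i * in_class i (K' - K)) \<le> \<Delta>"
    unfolding \<Delta> using loads_finite[of w K ds]
    by (metis enn2real_nonneg ennreal_enn2real ennreal_le_iff infinity_ennreal_def)
  have wr: "w r > 0" using w s(2) by auto
  have \<Delta>0: "\<Delta> \<ge> 0" by (simp add: \<Delta>)
  show "w r * m \<le> w r * in_class r K + m * \<Delta>"
  proof (cases "set (scan (r, m)) \<subseteq> K")
    case True
    then have "Pair r ` {..<m} \<subseteq> {p \<in> K. fst p = r}" by (auto simp: set_scan)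
    then have "card (Pair r ` {..<m}) \<le> in_class r K"
      unfolding in_class_def using K by (intro card_mono) auto
    then have "m \<le> in_class r K" by (simp add: card_image inj_on_def)
    then have "w r * m \<le> w r * in_class r K" using wr by simp
    with \<Delta>0 show ?thesis by (simp add: add_increasing2)
  next
    case False
    then obtain p where p: "p \<in> set (scan (r, m))" "p \<notin> K" by auto
    from loads_miss[OF ds p K(1), of w] p(1)
    have "ennreal (w r) \<le> loads w K ds" by (auto simp: set_scan)
    then have "w r \<le> \<Delta>"
      unfolding \<Delta> using loads_finite[of w K ds]
      by (metis enn2real_nonneg ennreal_enn2real ennreal_le_iff infinity_ennreal_def)
    then have "m * w r \<le> m * \<Delta>" by (intro mult_left_mono) auto
    with wr show ?thesis by (simp add: add_increasing mult.commute)
  qed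
qed

abbreviation opt :: "(nat \<Rightarrow> real) \<Rightarrow> nat \<Rightarrow> (nat \<times> nat) list \<Rightarrow> real" where
  "opt w k s \<equiv> enn2real (paging_opt w k (scans s))"

lemma opt_append:
  assumes "k \<ge> 1"
  shows "opt w k (s @ u) \<le> opt w k s + opt w k u"
proof -
  have "opt w k (s @ u) \<le> enn2real (paging_opt w k (scans s) + paging_opt w k (scans u))"
    using paging_opt_append[of w k "scans s" "scans u"] paging_opt_finite[OF assms]
    by (intro enn2real_mono) auto
  also have "\<dots> = opt w k s + opt w k u"
    using paging_opt_finite[OF assms] by (simp add: enn2real_plus)
  finally show ?thesis .
qed

text \<open>All that is kept of the randomized policy: \<open>y s i\<close> stands for the expected
  fraction of the cache held by class \<open>i\<close>, \<open>c s\<close> for the expected cost.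
  The step conditions are those of \<open>policy_step\<close>, averaged. The bound \<open>L\<close>
  reflects that representatives of the policies exist for finitely many request sequences at a
  time.\<close>

definition fractional_play ::
  "nat \<Rightarrow> (nat \<Rightarrow> real) \<Rightarrow> nat \<Rightarrow> nat \<Rightarrow> ((nat \<times> nat) list \<Rightarrow> nat \<Rightarrow> real) \<Rightarrow> ((nat \<times> nat) list \<Rightarrow> real) \<Rightarrow> bool"
  where
  "fractional_play l w k L y c \<longleftrightarrow>
     (\<forall>s. rounds l k s \<and> length s \<le> L \<longrightarrow> (\<forall>i<l. 0 \<le> y s i) \<and> (\<Sum>i<l. y s i) \<le> 1) \<and>
     (\<forall>s r m. rounds l k (s @ [(r, m)]) \<and> length s < L \<longrightarrow>
        k * (\<Sum>i<l. w i * max 0 (y (s @ [(r, m)]) i - y s i)) \<le> c (s @ [(r, m)]) - c s \<and>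
        w r * m \<le> w r * (k * y s r) + m * (c (s @ [(r, m)]) - c s))"

text \<open>The order of quantifiers matters: \<open>b\<close> is fixed before \<open>L\<close>,
  because the length of the starting history chosen later depends on \<open>b\<close>.\<close>

lemma wimp_fractional_play:
  assumes wimp: "wimp_competitive l w k \<rho>" and k: "k \<ge> 1" and w: "\<forall>i<l. w i > 0" and \<rho>: "\<rho> \<ge> 0"
  obtains b where "\<And>L. \<exists>y c. fractional_play l w k L y c \<and> c [] = 0 \<and>
    (\<forall>s. rounds l k s \<and> length s \<le> L \<longrightarrow> c s \<le> \<rho> * opt w k s + b)"
proof -
  let ?\<sigma> = "\<lambda>s. scans (s @ sweep l k)"
  let ?cost = "\<lambda>\<sigma> A. paging_cost w k \<sigma> (wimp_run A \<sigma>)"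
  obtain M b0 where M: "prob_space M"
    "\<And>\<sigma>. valid_paging_seq l \<sigma> \<Longrightarrow> ?cost \<sigma> \<in> borel_measurable M"
    "\<And>\<sigma>. valid_paging_seq l \<sigma> \<Longrightarrow> (\<integral>\<^sup>+ A. ?cost \<sigma> A \<partial>M) \<le> ennreal \<rho> * paging_opt w k \<sigma> + ennreal b0"
    using wimp unfolding wimp_competitive_def by blast
  \<comment> \<open>The policy is also charged for the final sweep; by subadditivity, this raises
    the optimum by at most the optimum of the sweep alone.\<close>
  define b where "b = \<rho> * opt w k (sweep l k) + max 0 b0"
  have "\<exists>y c. fractional_play l w k L y c \<and> c [] = 0 \<and>
    (\<forall>s. rounds l k s \<and> length s \<le> L \<longrightarrow> c s \<le> \<rho> * opt w k s + b)" for L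
  proof -
    define F where "F = ?\<sigma> ` {s. rounds l k s \<and> length s \<le> L}"
    have "finite {s. set s \<subseteq> {..<l} \<times> {..k} \<and> length s \<le> L}"
      by (intro finite_lists_length_le) auto
    then have F: "finite F" by (simp add: F_def rounds_def)
    have valid: "valid_paging_seq l \<sigma>" if "\<sigma> \<in> F" for \<sigma>
      using that by (fastforce simp: F_def valid_paging_seq_def rounds_def set_scans set_sweep simp del: scans_simps)
    have bound: "(\<integral>\<^sup>+ A. ?cost \<sigma> A \<partial>M) \<le> ennreal (\<rho> * enn2real (paging_opt w k \<sigma>) + max 0 b0)" if "\<sigma> \<in> F" for \<sigma>
    proof -
      have "paging_opt w k \<sigma> = ennreal (enn2real (paging_opt w k \<sigma>))"
        using paging_opt_finite[OF k] by simp
      then have "ennreal \<rho> * paging_opt w k \<sigma> + ennreal b0 =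
          ennreal (\<rho> * enn2real (paging_opt w k \<sigma>)) + ennreal (max 0 b0)"
        using \<rho> by (metis ennreal_mult enn2real_nonneg ennreal_max_0)
      also have "\<dots> = ennreal (\<rho> * enn2real (paging_opt w k \<sigma>) + max 0 b0)"
        using \<rho> by (intro ennreal_plus[symmetric]) auto
      finally show ?thesis using M(3)[OF valid[OF that]] by simp
    qed
    obtain N where N: "prob_space N" "sets N = Pow (space N)"
      "\<And>\<sigma> A. \<sigma> \<in> F \<Longrightarrow> A \<in> space N \<Longrightarrow> ?cost \<sigma> A < \<infinity>"
      "\<And>\<sigma>. \<sigma> \<in> F \<Longrightarrow> (\<integral>\<^sup>+ A. ?cost \<sigma> A \<partial>N) = (\<integral>\<^sup>+ A. ?cost \<sigma> A \<partial>M)"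
    proof (rule discrete_representatives[of M F ?cost])
      show "(\<integral>\<^sup>+ A. ?cost \<sigma> A \<partial>M) < \<infinity>" if "\<sigma> \<in> F" for \<sigma>
        using bound[OF that] by (rule order.strict_trans1) simp
    qed (use M F valid countable_range_paging_cost in auto)
    interpret N: prob_space N by fact
    have meas [measurable]: "f \<in> borel_measurable N" for f :: "_ \<Rightarrow> real"
      using N(2) by (auto simp: measurable_def)
    have serves: "serves k (trajectory l k A s) (scans s)"
      and loads: "loads w {} (trajectory l k A s) \<le> ?cost (?\<sigma> s) A"
      if "A \<in> space N" "rounds l k s" "length s \<le> L" for A s
      using trajectory_serves[of w k s l A] N(3)[of "?\<sigma> s" A] that by (auto simp: F_def simp del: scans_simps)
    let ?n = "\<lambda>s i A. real (in_class i (cache l k A s))"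
    define y where "y s i = N.expectation (?n s i) / k" for s i
    define c where "c s = N.expectation (\<lambda>A. cost w l k A s)" for s
    have cache: "finite (cache l k A s)" "card (cache l k A s) \<le> k"
      if "A \<in> space N" "rounds l k s" "length s \<le> L" for A s
      using serves_last[OF serves[OF that]] by (auto simp: cache_def)
    have n_le: "?n s i A \<le> k" if "A \<in> space N" "rounds l k s" "length s \<le> L" for A s i
    proof -
      have "in_class i (cache l k A s) \<le> card (cache l k A s)"
        unfolding in_class_def using cache[OF that] by (intro card_mono) auto
      with cache[OF that] show ?thesis by simp
    qed
    have int_n: "integrable N (?n s i)" if "rounds l k s" "length s \<le> L" for s i
      using n_le that by (intro N.integrable_const_bound[where B = k]) auto
    have nn_cost: "(\<integral>\<^sup>+ A. ennreal (cost w l k A s) \<partial>N) \<le> ennreal (\<rho> * opt w k s + b)"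
      if "rounds l k s" "length s \<le> L" for s
    proof -
      have \<sigma>: "?\<sigma> s \<in> F" using that by (auto simp: F_def simp del: scans_simps)
      have "(\<integral>\<^sup>+ A. ennreal (cost w l k A s) \<partial>N) \<le> (\<integral>\<^sup>+ A. ?cost (?\<sigma> s) A \<partial>N)"
        using loads that loads_finite unfolding cost_def
        by (intro nn_integral_mono) (simp add: less_top del: scans_simps)
      also have "\<dots> \<le> ennreal (\<rho> * opt w k (s @ sweep l k) + max 0 b0)"
        using N(4)[OF \<sigma>] bound[OF \<sigma>] by simp
      also have "\<dots> \<le> ennreal (\<rho> * opt w k s + b)"
        using mult_left_mono[OF opt_append[OF k, of w s "sweep l k"] \<rho>]
        by (intro ennreal_leI) (simp add: b_def algebra_simps)
      finally show ?thesis .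
    qed
    have int_c: "integrable N (\<lambda>A. cost w l k A s)" if "rounds l k s" "length s \<le> L" for s
    proof (rule integrableI_nonneg)
      show "(\<integral>\<^sup>+ A. ennreal (cost w l k A s) \<partial>N) < \<infinity>"
        using nn_cost[OF that] by (rule order.strict_trans1) simp
    qed (auto simp: cost_def)
    have b0: "0 \<le> \<rho> * opt w k s + b" for s
      using \<rho> by (simp add: b_def)
    have c_le: "c s \<le> \<rho> * opt w k s + b" if "rounds l k s" "length s \<le> L" for s
    proof -
      have "ennreal (c s) = (\<integral>\<^sup>+ A. ennreal (cost w l k A s) \<partial>N)"
        unfolding c_def using int_c[OF that] by (intro nn_integral_eq_integral[symmetric]) (auto simp: cost_def)
      with nn_cost[OF that] have "ennreal (c s) \<le> ennreal (\<rho> * opt w k s + b)" by simp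
      with b0[of s] show ?thesis by (simp add: ennreal_le_iff)
    qed
    have "c [] = 0"
      by (simp add: c_def cost_def trajectory_def)
    have y_sum: "(\<Sum>i<l. y s i) \<le> 1" if "rounds l k s" "length s \<le> L" for s
    proof -
      have "N.expectation (\<lambda>A. \<Sum>i<l. ?n s i A) \<le> k"
      proof (rule N.integral_le_const)
        show "AE A in N. (\<Sum>i<l. ?n s i A) \<le> k"
        proof (rule AE_I2)
          fix A assume "A \<in> space N"
          then have "(\<Sum>i<l. in_class i (cache l k A s)) \<le> k"
            using cache that sum_in_class_le order_trans by blast
          then show "(\<Sum>i<l. ?n s i A) \<le> k" by (metis of_nat_le_iff of_nat_sum)
        qed
      qed (use int_n that in auto)
      then show ?thesis
        using k int_n that by (simp add: y_def Bochner_Integration.integral_sum sum_divide_distrib[symmetric])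
    qed
    have step: "k * (\<Sum>i<l. w i * max 0 (y (s @ [(r, m)]) i - y s i)) \<le> c (s @ [(r, m)]) - c s \<and>
        w r * m \<le> w r * (k * y s r) + m * (c (s @ [(r, m)]) - c s)"
      if s': "rounds l k (s @ [(r, m)])" "length s < L" for s r m
    proof
      let ?s = "s @ [(r, m)]"
      let ?d = "\<lambda>i A. real (in_class i (cache l k A ?s - cache l k A s))"
      let ?\<Delta> = "\<lambda>A. cost w l k A ?s - cost w l k A s"
      have ss: "rounds l k s" "length s \<le> L" "rounds l k ?s" "length ?s \<le> L" "(r, m) \<in> {..<l} \<times> {..k}"
        using s' by (auto simp: rounds_def)
      note ps = policy_step[OF ss(1,5) w serves[OF _ ss(1,2)] serves[OF _ ss(3,4)]]
      have int_\<Delta>: "integrable N ?\<Delta>" "N.expectation ?\<Delta> = c ?s - c s"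
        using int_c ss by (auto simp: c_def)
      have d_le: "?d i A \<le> k" if "A \<in> space N" for i A
      proof -
        have "?d i A \<le> ?n ?s i A"
          unfolding in_class_def using cache[OF that ss(3,4)] by (auto intro: card_mono)
        with n_le[OF that ss(3,4), of i] show ?thesis by simp
      qed
      have int_d: "integrable N (?d i)" for i
        using d_le by (intro N.integrable_const_bound[where B = k]) auto
      \<comment> \<open>A class grows by at most its newly loaded pages. Their expected number is
        nonnegative, which gives the bound for the positive part too.\<close>
      have y_diff: "k * max 0 (y ?s i - y s i) \<le> N.expectation (?d i)" for i
      proof -
        have "N.expectation (\<lambda>A. ?n ?s i A - ?n s i A) \<le> N.expectation (?d i)"
        proof (intro integral_mono)
          fix A assume A: "A \<in> space N"
          show "?n ?s i A - ?n s i A \<le> ?d i A"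
            using in_class_le[OF cache(1)[OF A ss(1,2)] cache(1)[OF A ss(3,4)], of i] by linarith
        qed (use int_n int_d ss in auto)
        then have "k * (y ?s i - y s i) \<le> N.expectation (?d i)"
          using k int_n ss by (simp add: y_def right_diff_distrib)
        moreover have "0 \<le> N.expectation (?d i)" by simp
        ultimately show ?thesis using k by (simp add: max_def)
      qed
      have "k * (\<Sum>i<l. w i * max 0 (y ?s i - y s i)) = (\<Sum>i<l. w i * (k * max 0 (y ?s i - y s i)))"
        by (simp add: sum_distrib_left mult.left_commute)
      also have "\<dots> \<le> (\<Sum>i<l. w i * N.expectation (?d i))"
        using y_diff w by (intro sum_mono mult_left_mono) (auto simp: less_imp_le)
      also have "\<dots> = N.expectation (\<lambda>A. \<Sum>i<l. w i * ?d i A)"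
        using int_d by (simp add: Bochner_Integration.integral_sum)
      also have "\<dots> \<le> N.expectation ?\<Delta>"
        using int_d int_\<Delta> ps(4) by (intro integral_mono) auto
      finally show "k * (\<Sum>i<l. w i * max 0 (y ?s i - y s i)) \<le> c ?s - c s"
        using int_\<Delta> by simp
      have "N.expectation (\<lambda>A. w r * m) \<le> N.expectation (\<lambda>A. w r * ?n s r A + m * ?\<Delta> A)"
        using int_n ss int_\<Delta>(1) ps(5) by (intro integral_mono) auto
      also have "\<dots> = w r * N.expectation (?n s r) + m * N.expectation ?\<Delta>"
        using int_n ss int_\<Delta>(1) by (subst Bochner_Integration.integral_add) auto
      finally show "w r * m \<le> w r * (k * y s r) + m * (c ?s - c s)"
        using k int_\<Delta>(2) by (simp add: y_def N.prob_space)
    qed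
    have "fractional_play l w k L y c"
      unfolding fractional_play_def using y_sum step by (auto simp: y_def)
    with \<open>c [] = 0\<close> c_le show ?thesis by blast
  qed
  then show thesis by (rule that)
qed

section \<open>Fractional play\<close>

lemma play_step:
  assumes "fractional_play l w k L y c" "rounds l k (s @ [(r, m)])" "length s < L"
  shows "k * (\<Sum>i<l. w i * max 0 (y (s @ [(r, m)]) i - y s i)) \<le> c (s @ [(r, m)]) - c s"
    and "w r * m \<le> w r * (k * y s r) + m * (c (s @ [(r, m)]) - c s)"
  using assms unfolding fractional_play_def by blast+

text \<open>The positive part is subadditive, so the bounds for single rounds add up.\<close>

lemma play_increment:
  assumes play: "fractional_play l w k L y c" and w: "\<forall>i<l. w i > 0"
    and "rounds l k (s @ v)" "length (s @ v) \<le> L"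
  shows "k * (\<Sum>i<l. w i * max 0 (y (s @ v) i - y s i)) \<le> c (s @ v) - c s"
  using assms(3,4)
proof (induction v rule: rev_induct)
  case (snoc x v)
  obtain r m where x: "x = (r, m)" by (cases x)
  let ?y = "y (s @ v)" and ?y' = "y (s @ v @ [(r, m)])"
  have "(\<Sum>i<l. w i * max 0 (?y' i - y s i)) \<le> (\<Sum>i<l. w i * (max 0 (?y' i - ?y i) + max 0 (?y i - y s i)))"
    using w by (intro sum_mono mult_left_mono) (auto simp: less_imp_le)
  also have "\<dots> = (\<Sum>i<l. w i * max 0 (?y' i - ?y i)) + (\<Sum>i<l. w i * max 0 (?y i - y s i))"
    by (simp add: distrib_left sum.distrib)
  finally have "k * (\<Sum>i<l. w i * max 0 (?y' i - y s i)) \<le>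
      k * ((\<Sum>i<l. w i * max 0 (?y' i - ?y i)) + (\<Sum>i<l. w i * max 0 (?y i - y s i)))"
    by (intro mult_left_mono) auto
  moreover have "k * (\<Sum>i<l. w i * max 0 (?y' i - ?y i)) \<le> c (s @ v @ [(r, m)]) - c (s @ v)"
    using play_step(1)[OF play, of "s @ v" r m] snoc.prems by (simp add: x)
  moreover have "k * (\<Sum>i<l. w i * max 0 (?y i - y s i)) \<le> c (s @ v) - c s"
    using snoc by (intro snoc.IH) auto
  ultimately show ?case by (simp add: x distrib_left)
qed simp

lemma play_cost_mono:
  assumes "fractional_play l w k L y c" "\<forall>i<l. w i > 0"
    and "rounds l k (s @ v)" "length (s @ v) \<le> L"
  shows "c s \<le> c (s @ v)"
proof -
  have "0 \<le> k * (\<Sum>i<l. w i * max 0 (y (s @ v) i - y s i))"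
    using assms(2) by (intro mult_nonneg_nonneg sum_nonneg) (auto simp: less_imp_le)
  with play_increment[OF assms] show ?thesis by linarith
qed

text \<open>The additive term of the paging algorithm may depend arbitrarily on \<open>k\<close>. It disappears if the
  simulation starts at a history at which the excess \<open>c s - \<rho> * opt w k s\<close> is nearly maximal.\<close>
lemma saturated_start:
  assumes c0: "c [] = 0" and k: "k \<ge> 1" and \<rho>: "\<rho> \<ge> 0"
    and c: "\<And>s. rounds l k s \<Longrightarrow> length s \<le> (nat \<lceil>b\<rceil> + 2) * n \<Longrightarrow> c s \<le> \<rho> * opt w k s + b"
  obtains s0 where "rounds l k s0" "length s0 + n \<le> (nat \<lceil>b\<rceil> + 2) * n"
    "\<And>s. rounds l k s \<Longrightarrow> length s \<le> n \<Longrightarrow> c (s0 @ s) - c s0 \<le> \<rho> * opt w k s + 1"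
proof -
  define G where "G s = c s - \<rho> * opt w k s" for s
  let ?B = "nat \<lceil>b\<rceil> + 1"
  have "opt w k [] = 0"
    using paging_opt_le_loads[of k "[]" "[]" w] by (simp add: serves_def)
  then have G0: "G [] = 0" by (simp add: G_def c0)
  have "\<exists>s0. rounds l k s0 \<and> length s0 \<le> ?B * n \<and>
      (\<forall>s. rounds l k s \<and> length s \<le> n \<longrightarrow> G (s0 @ s) \<le> G s0 + 1)"
  proof (rule ccontr)
    \<comment> \<open>Each failure yields an extension by at most \<open>n\<close> rounds that
      raises \<open>G\<close> by more than 1. After \<open>?B\<close> of them \<open>G\<close> would
      exceed its upper bound \<open>b\<close>. The total length allows for \<open>n\<close> further
      rounds, the play that follows \<open>s0\<close>.\<close>
    assume stuck: "\<not> ?thesis"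
    have "\<exists>s. rounds l k s \<and> length s \<le> j * n \<and> G s \<ge> j" if "j \<le> ?B" for j
      using that
    proof (induction j)
      case 0
      show ?case by (intro exI[of _ "[]"]) (simp add: rounds_def G0)
    next
      case (Suc j)
      then obtain s where s: "rounds l k s" "length s \<le> j * n" "G s \<ge> j" by auto
      have "j * n \<le> ?B * n" using Suc.prems by (intro mult_right_mono) auto
      with s stuck obtain u where "rounds l k u" "length u \<le> n" "G (s @ u) > G s + 1"
        by (meson le_trans not_le)
      with s show ?case by (intro exI[of _ "s @ u"]) auto
    qed
    from this[OF order_refl] obtain s where s: "rounds l k s" "length s \<le> ?B * n" "G s \<ge> ?B"
      by blast
    have "?B * n \<le> (nat \<lceil>b\<rceil> + 2) * n" by simp
    with s c[of s] have "G s \<le> b" by (simp add: G_def)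
    moreover have "b < ?B" by linarith
    ultimately show False using s(3) by linarith
  qed
  then obtain s0 where s0: "rounds l k s0" "length s0 \<le> ?B * n"
    "\<And>s. rounds l k s \<Longrightarrow> length s \<le> n \<Longrightarrow> G (s0 @ s) \<le> G s0 + 1" by blast
  show thesis
  proof
    show "length s0 + n \<le> (nat \<lceil>b\<rceil> + 2) * n" using s0(2) by simp
    fix s assume "rounds l k s" "length s \<le> n"
    \<comment> \<open>Subadditivity of \<open>opt\<close> turns the bound on the excess into one in
      which the optimum of \<open>s0\<close> cancels.\<close>
    with s0(3)[of s] mult_left_mono[OF opt_append[OF k, of w s0 s] \<rho>]
    show "c (s0 @ s) - c s0 \<le> \<rho> * opt w k s + 1" by (simp add: G_def algebra_simps)
  qed fact
qed

section \<open>Repeated rounds and their optimum\<close>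

definition blocks :: "nat list \<Rightarrow> 'a list \<Rightarrow> 'a list" where
  "blocks Ns xs = concat (map (\<lambda>(N, x). replicate N x) (zip Ns xs))"

lemma blocks_Nil [simp]: "blocks [] [] = []"
  by (simp add: blocks_def)

lemma blocks_snoc [simp]:
  "length Ns = length xs \<Longrightarrow> blocks (Ns @ [N]) (xs @ [x]) = blocks Ns xs @ replicate N x"
  by (simp add: blocks_def)

lemma set_blocks: "set (blocks Ns xs) \<subseteq> set xs"
  by (auto simp: blocks_def dest: set_zip_rightD split: if_splits)

lemma length_blocks:
  "length Ns = length xs \<Longrightarrow> \<forall>N\<in>set Ns. N \<le> R \<Longrightarrow> length (blocks Ns xs) \<le> length xs * R"
  by (induction Ns xs rule: list_induct2) (auto simp: blocks_def)

lemma rounds_blocks: "rounds l k xs \<Longrightarrow> rounds l k (blocks Ns xs)"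
  using set_blocks unfolding rounds_def by (metis order_trans)

lemma load_weight_Sigma:
  fixes w :: "nat \<Rightarrow> real" and a b :: "nat \<Rightarrow> nat"
  assumes "\<forall>i<l. w i > 0"
  shows "load_weight w (SIGMA i:{..<l}. {a i..<b i}) = ennreal (\<Sum>i<l. w i * real (b i - a i))"
proof -
  have "load_weight w (SIGMA i:{..<l}. {a i..<b i}) = (\<Sum>i<l. \<Sum>n\<in>{a i..<b i}. ennreal (w i))"
    unfolding load_weight_def by (subst sum.Sigma) (auto intro: sum.cong)
  also have "\<dots> = (\<Sum>i<l. ennreal (w i * real (b i - a i)))"
    using assms by (intro sum.cong)
      (auto simp: ennreal_mult less_imp_le ennreal_of_nat_eq_real_of_nat mult.commute)
  also have "\<dots> = ennreal (\<Sum>i<l. w i * real (b i - a i))"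
    using assms by (intro sum_ennreal) (auto simp: less_imp_le)
  finally show ?thesis .
qed

lemma opt_blocks:
  assumes "\<forall>(K, s)\<in>set zs. finite K \<and> card K \<le> k \<and> set (scans s) \<subseteq> K"
  shows "paging_opt w k (scans (concat (map snd zs))) \<le> loads w {} (map fst zs)"
proof -
  have "scans (concat (map snd zs)) = concat (map snd (map (map_prod id scans) zs))"
    by (induction zs) auto
  moreover have "\<forall>(K, \<sigma>)\<in>set (map (map_prod id scans) zs). finite K \<and> card K \<le> k \<and> set \<sigma> \<subseteq> K"
    using assms by fastforce
  from paging_opt_blocks[OF this, of w]
  have "paging_opt w k (concat (map snd (map (map_prod id scans) zs))) \<le> loads w {} (map fst zs)"
    by (simp add: comp_def)
  ultimately show ?thesis by simp
qed

lemma opt_replicate: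
  fixes w :: "nat \<Rightarrow> real"
  assumes "(r, m) \<in> {..<l} \<times> {..k}" and w: "\<forall>i<l. w i > 0"
  shows "opt w k (replicate N (r, m)) \<le> k * sum w {..<l}"
proof -
  let ?K = "{r} \<times> {..<m}"
  have scans: "set (scans (replicate N (r, m))) \<subseteq> ?K"
    by (auto simp: set_scans)
  have "paging_opt w k (scans (replicate N (r, m))) \<le> load_weight w ?K"
    using opt_blocks[of "[(?K, replicate N (r, m))]" k w] scans assms
    by (auto simp: card_cartesian_product)
  also have "load_weight w ?K = (\<Sum>p\<in>?K. ennreal (w r))"
    unfolding load_weight_def by (intro sum.cong) auto
  also have "\<dots> = ennreal (m * w r)"
    using assms by (simp add: card_cartesian_product ennreal_mult less_imp_le ennreal_of_nat_eq_real_of_nat)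
  also have "\<dots> \<le> ennreal (k * sum w {..<l})"
    using assms by (intro ennreal_leI mult_mono member_le_sum) (auto simp: less_imp_le)
  finally have "opt w k (replicate N (r, m)) \<le> enn2real (ennreal (k * sum w {..<l}))"
    by (intro enn2real_mono) auto
  also have "\<dots> = k * sum w {..<l}"
    using w by (intro enn2real_ennreal mult_nonneg_nonneg sum_nonneg) (auto simp: less_imp_le)
  finally show ?thesis .
qed

text \<open>The requested pages are loaded afresh for each element of \<open>xs\<close>. The bound
  is generous, but it does not depend on the numbers of repetitions; it serves to choose
  \<open>R\<close>, not to bound the competitive ratio.\<close>

lemma opt_blocks_crude:
  fixes w :: "nat \<Rightarrow> real"
  assumes k: "k \<ge> 1" and w: "\<forall>i<l. w i > 0"
  shows "length Ns = length xs \<Longrightarrow> rounds l k xs \<Longrightarrow>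
    opt w k (blocks Ns xs) \<le> length xs * (k * sum w {..<l})"
proof (induction Ns xs rule: list_induct2)
  case Nil
  show ?case using paging_opt_le_loads[of k "[]" "[]" w] by (simp add: serves_def)
next
  case (Cons N Ns x xs)
  obtain r m where x: "x = (r, m)" by (cases x)
  have "opt w k (blocks (N # Ns) (x # xs)) \<le> opt w k (replicate N x) + opt w k (blocks Ns xs)"
    using opt_append[OF k, of w "replicate N x" "blocks Ns xs"] by (simp add: blocks_def)
  also have "\<dots> \<le> k * sum w {..<l} + length xs * (k * sum w {..<l})"
    unfolding x using Cons w by (intro add_mono opt_replicate[of r m l k]) (auto simp: x rounds_def)
  finally show ?case by (simp add: algebra_simps)
qed

section \<open>Offline allocations as cache schedules\<close>

definition discretize :: "nat \<Rightarrow> nat \<times> real \<Rightarrow> nat \<times> nat" where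
  "discretize k = (\<lambda>(r, c). (r, nat \<lfloor>k * c\<rfloor>))"

lemma rounds_discretize:
  assumes "valid_alloc_seq l \<sigma>"
  shows "rounds l k (map (discretize k) \<sigma>)"
proof -
  have "nat \<lfloor>k * c\<rfloor> \<le> k" if "0 \<le> c" "c \<le> 1" for c :: real
  proof -
    have "k * c \<le> k" using that by (simp add: mult_left_le)
    then show ?thesis by linarith
  qed
  then show ?thesis
    using assms by (auto simp: rounds_def discretize_def valid_alloc_seq_def)
qed

definition movement :: "nat \<Rightarrow> (nat \<Rightarrow> real) \<Rightarrow> nat \<Rightarrow> (nat \<Rightarrow> nat \<Rightarrow> real) \<Rightarrow> real" where
  "movement l w n x = (\<Sum>t\<in>{1..n}. \<Sum>i<l. w i * \<bar>x t i - x (t - 1) i\<bar>)"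

definition feasible :: "nat \<Rightarrow> (nat \<times> real) list \<Rightarrow> (nat \<Rightarrow> nat \<Rightarrow> real) \<Rightarrow> bool" where
  "feasible l \<sigma> x \<longleftrightarrow> (\<forall>t\<le>length \<sigma>. x t \<in> prob_simplex l) \<and>
     (\<forall>t\<in>{1..length \<sigma>}. x t (fst (\<sigma> ! (t - 1))) \<ge> snd (\<sigma> ! (t - 1)))"

lemma alloc_cost_eq:
  "alloc_cost l w \<sigma> x = (if feasible l \<sigma> x then ennreal (movement l w (length \<sigma>) x) else \<infinity>)"
  by (simp add: alloc_cost_def feasible_def movement_def)

text \<open>The allocation \<open>x\<close> becomes the cache of the first
  \<open>nat \<lfloor>k * x t i\<rfloor>\<close> pages of each class \<open>i\<close>. Initial
  segments are nested, so only growth is paid for, and thresholds rounded down in the same way stay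
  satisfied. Loading the initial cache gives \<open>k * sum w {..<l}\<close>; rounding adds one page
  per class and request. Repetitions are free, so \<open>Ns\<close> does not enter the
  bound.\<close>

lemma opt_le_movement:
  fixes w :: "nat \<Rightarrow> real"
  assumes k: "k \<ge> 1" and w: "\<forall>i<l. w i > 0" and \<sigma>: "valid_alloc_seq l \<sigma>" and x: "feasible l \<sigma> x"
    and Ns: "length Ns = length \<sigma>"
  shows "opt w k (blocks Ns (map (discretize k) \<sigma>)) \<le>
    k * movement l w (length \<sigma>) x + (length \<sigma> + k) * sum w {..<l}"
proof -
  let ?n = "length \<sigma>"
  define N where "N t i = nat \<lfloor>k * x t i\<rfloor>" for t i
  define K where "K t = (SIGMA i:{..<l}. {0..<N t i})" for t
  have simplex: "0 \<le> x t i" "(\<Sum>i<l. x t i) = 1" if "t \<le> ?n" "i < l" for t i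
    using x that by (auto simp: feasible_def prob_simplex_def)
  have N_le: "real (N t i) \<le> k * x t i" if "t \<le> ?n" "i < l" for t i
    using simplex[OF that] by (simp add: N_def)
  have card: "card (K t) \<le> k" if t: "t \<le> ?n" for t
  proof -
    have "real (card (K t)) = (\<Sum>i<l. real (N t i))" by (simp add: K_def)
    also have "\<dots> \<le> (\<Sum>i<l. k * x t i)" using N_le t by (intro sum_mono) auto
    also have "\<dots> = k" using x t by (simp add: sum_distrib_left[symmetric] feasible_def prob_simplex_def)
    finally show ?thesis by simp
  qed
  \<comment> \<open>The request at position \<open>t\<close> is answered by the allocation at time
    \<open>Suc t\<close>.\<close>
  define zs where "zs = map (\<lambda>t. (K (Suc t), replicate (Ns ! t) (map (discretize k) \<sigma> ! t))) [0..<?n]"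
  have "map snd zs = map (\<lambda>(N, x). replicate N x) (zip Ns (map (discretize k) \<sigma>))"
    using Ns by (intro nth_equalityI) (auto simp: zs_def)
  then have zs_snd: "concat (map snd zs) = blocks Ns (map (discretize k) \<sigma>)"
    by (simp add: blocks_def)
  have zs_fst: "map fst zs = map K [1..<Suc ?n]"
    by (intro nth_equalityI) (auto simp: zs_def simp del: upt_Suc)
  have "set (scans (replicate (Ns ! t) (map (discretize k) \<sigma> ! t))) \<subseteq> K (Suc t)" if t: "t < ?n" for t
  proof -
    obtain r c where rc: "\<sigma> ! t = (r, c)" by (cases "\<sigma> ! t")
    have "r < l" using \<sigma> nth_mem[OF t] rc by (auto simp: valid_alloc_seq_def)
    have "c \<le> x (Suc t) r"
      using x t rc by (auto simp: feasible_def dest!: bspec[of _ _ "Suc t"])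
    then have "nat \<lfloor>k * c\<rfloor> \<le> N (Suc t) r"
      unfolding N_def by (intro nat_mono floor_mono mult_left_mono) auto
    with \<open>r < l\<close> t rc show ?thesis by (auto simp: set_scans K_def discretize_def)
  qed
  then have "\<forall>(K, s)\<in>set zs. finite K \<and> card K \<le> k \<and> set (scans s) \<subseteq> K"
    using card by (auto simp: zs_def K_def)
  from opt_blocks[OF this, of w]
  have "paging_opt w k (scans (blocks Ns (map (discretize k) \<sigma>))) \<le> loads w {} (map K [1..<Suc ?n])"
    unfolding zs_snd zs_fst .
  \<comment> \<open>\<open>movement\<close> compares time 1 with \<open>x 0\<close>, so the cache
    \<open>K 0\<close> is loaded beforehand.\<close>
  also have "\<dots> \<le> load_weight w (K 0 - {}) + loads w (K 0) (map K [1..<Suc ?n])"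
    by (intro loads_triangle) (auto simp: K_def)
  also have "\<dots> = load_weight w (K 0) + (\<Sum>t\<in>{1..?n}. load_weight w (K t - K (t - 1)))"
    unfolding loads_map_upt by simp
  also have "load_weight w (K 0) \<le> ennreal (k * sum w {..<l})"
    unfolding K_def load_weight_Sigma[OF w]
  proof (intro ennreal_leI)
    have "(\<Sum>i<l. w i * real (N 0 i - 0)) \<le> (\<Sum>i<l. w i * k)"
    proof (intro sum_mono mult_left_mono)
      fix i assume i: "i \<in> {..<l}"
      have "x 0 i \<le> (\<Sum>i<l. x 0 i)" using i simplex by (intro member_le_sum) auto
      with simplex[of 0 i] i have "k * x 0 i \<le> k" by (simp add: mult_left_le)
      with N_le[of 0 i] i show "real (N 0 i - 0) \<le> k" by simp
    qed (use w in \<open>auto simp: less_imp_le\<close>)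
    then show "(\<Sum>i<l. w i * real (N 0 i - 0)) \<le> k * sum w {..<l}"
      by (simp add: sum_distrib_left mult.commute)
  qed
  also have "(\<Sum>t\<in>{1..?n}. load_weight w (K t - K (t - 1))) \<le>
      (\<Sum>t\<in>{1..?n}. ennreal (\<Sum>i<l. w i * (k * \<bar>x t i - x (t - 1) i\<bar> + 1)))"
  proof (intro sum_mono)
    fix t assume t: "t \<in> {1..?n}"
    have "K t - K (t - 1) = (SIGMA i:{..<l}. {N (t - 1) i..<N t i})"
      by (auto simp: K_def)
    \<comment> \<open>Subtraction on \<open>nat\<close> yields exactly the growth, and rounding down
      changes a difference by less than 1.\<close>
    moreover have "real (N t i - N (t - 1) i) \<le> k * \<bar>x t i - x (t - 1) i\<bar> + 1" if "i < l" for i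
    proof -
      have nonneg: "0 \<le> k * x t i" "0 \<le> k * x (t - 1) i" using simplex t that by auto
      have "k * \<bar>x t i - x (t - 1) i\<bar> = \<bar>k * x t i - k * x (t - 1) i\<bar>"
        by (simp add: right_diff_distrib[symmetric] abs_mult)
      then show ?thesis using nonneg unfolding N_def by linarith
    qed
    ultimately show "load_weight w (K t - K (t - 1)) \<le> ennreal (\<Sum>i<l. w i * (k * \<bar>x t i - x (t - 1) i\<bar> + 1))"
      using w by (auto simp: load_weight_Sigma less_imp_le intro!: ennreal_leI sum_mono mult_left_mono)
  qed
  also have "\<dots> = ennreal (\<Sum>t\<in>{1..?n}. \<Sum>i<l. w i * (k * \<bar>x t i - x (t - 1) i\<bar> + 1))"
    using w by (intro sum_ennreal sum_nonneg mult_nonneg_nonneg) (auto simp: less_imp_le)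
  also have "(\<Sum>t\<in>{1..?n}. \<Sum>i<l. w i * (k * \<bar>x t i - x (t - 1) i\<bar> + 1)) =
      k * movement l w ?n x + ?n * sum w {..<l}"
    by (simp add: movement_def distrib_left sum.distrib sum_distrib_left mult.left_commute)
  also have "ennreal (k * sum w {..<l}) + ennreal (k * movement l w ?n x + ?n * sum w {..<l}) =
      ennreal (k * movement l w ?n x + (?n + k) * sum w {..<l})"
    using w by (subst ennreal_plus[symmetric])
      (auto simp: movement_def algebra_simps less_imp_le intro!: sum_nonneg mult_nonneg_nonneg add_nonneg_nonneg)
  finally have "opt w k (blocks Ns (map (discretize k) \<sigma>)) \<le>
      enn2real (ennreal (k * movement l w ?n x + (?n + k) * sum w {..<l}))"
    by (simp add: enn2real_mono add_mono)
  also have "\<dots> = k * movement l w ?n x + (?n + k) * sum w {..<l}"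
    using w by (intro enn2real_ennreal)
      (auto simp: movement_def less_imp_le intro!: sum_nonneg mult_nonneg_nonneg add_nonneg_nonneg)
  finally show ?thesis .
qed

text \<open>Repeating a round costs the optimum nothing, so among \<open>R\<close> repetitions there is one that costs the
  algorithm at most \<open>\<delta>\<close>; just before it nearly all requested pages must be in the cache.\<close>
lemma repeat_until_cheap:
  fixes w :: "nat \<Rightarrow> real" and \<delta> \<rho> :: real
  assumes play: "fractional_play l w k L y c" and w: "\<forall>i<l. w i > 0" and k: "k \<ge> 1" and \<rho>: "\<rho> \<ge> 0"
    and s0: "rounds l k s0" "length s0 + n * R \<le> L"
    and stable: "\<And>s. rounds l k s \<Longrightarrow> length s \<le> n * R \<Longrightarrow> c (s0 @ s) - c s0 \<le> \<rho> * opt w k s + 1"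
    and R: "\<rho> * (n * (k * sum w {..<l})) + 1 < R * \<delta>"
  obtains st :: "(nat \<times> nat) list \<Rightarrow> (nat \<times> nat) list"
  where "st [] = s0" "\<And>xs x. \<exists>N. st (xs @ [x]) = st xs @ replicate N x"
    "\<And>xs. rounds l k xs \<Longrightarrow> length xs \<le> n \<Longrightarrow>
      \<exists>Ns. length Ns = length xs \<and> st xs = s0 @ blocks Ns xs \<and> length (blocks Ns xs) \<le> n * R"
    "\<And>xs x. rounds l k (xs @ [x]) \<Longrightarrow> length (xs @ [x]) \<le> n \<Longrightarrow>
      length (st (xs @ [x])) < L \<and> c (st (xs @ [x]) @ [x]) - c (st (xs @ [x])) \<le> \<delta>"
proof -
  define cheap where "cheap s x N \<longleftrightarrow> c (s @ replicate N x @ [x]) - c (s @ replicate N x) \<le> \<delta>" for s x N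
  \<comment> \<open>The number of repetitions depends only on the state reached so far, which keeps
    \<open>st\<close> online. \<open>LEAST\<close> is meaningful only if some repetition is cheap;
    \<open>ex_cheap\<close> provides one for the histories considered.\<close>
  define st where "st = foldl (\<lambda>s x. s @ replicate (LEAST N. cheap s x N) x) s0"
  have st_snoc: "st (xs @ [x]) = st xs @ replicate (LEAST N. cheap (st xs) x N) x" for xs x
    by (simp add: st_def)
  have ex_cheap: "\<exists>N<R. cheap (s0 @ blocks Ns xs) x N"
    if xs: "rounds l k (xs @ [x])" "length (xs @ [x]) \<le> n"
      and Ns: "length Ns = length xs" "\<forall>N\<in>set Ns. N \<le> R" for Ns xs x
  proof (rule ccontr)
    assume none: "\<not> ?thesis"
    let ?s = "s0 @ blocks Ns xs"
    have len: "length (blocks (Ns @ [N]) (xs @ [x])) \<le> n * R" if "N \<le> R" for N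
    proof -
      have "length (blocks (Ns @ [N]) (xs @ [x])) \<le> length (xs @ [x]) * R"
        using Ns that by (intro length_blocks) auto
      also have "\<dots> \<le> n * R" using xs(2) by (intro mult_right_mono) auto
      finally show ?thesis .
    qed
    have valid: "rounds l k (blocks (Ns @ [N]) (xs @ [x]))" for N
      by (rule rounds_blocks[OF xs(1)])
    \<comment> \<open>If all \<open>R\<close> repetitions cost more than \<open>\<delta>\<close>,
      the total contradicts \<open>stable\<close>, because the optimum does not grow with the number
      of repetitions.\<close>
    have "N * \<delta> \<le> c (?s @ replicate N x) - c ?s" if "N \<le> R" for N
      using that
    proof (induction N)
      case (Suc N)
      then have "\<not> cheap ?s x N" using none by auto
      with Suc show ?case
        by (simp add: cheap_def replicate_append_same[symmetric] algebra_simps del: replicate_append_same)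
    qed simp
    from this[OF order_refl] have "R * \<delta> \<le> c (?s @ replicate R x) - c s0"
      using play_cost_mono[OF play w, of s0 "blocks Ns xs"] s0 valid[of 0] len[of 0] Ns by simp
    also have "\<dots> \<le> \<rho> * opt w k (blocks (Ns @ [R]) (xs @ [x])) + 1"
      using stable[OF valid len[OF order_refl]] Ns by simp
    also have "\<dots> \<le> \<rho> * (n * (k * sum w {..<l})) + 1"
    proof -
      have "opt w k (blocks (Ns @ [R]) (xs @ [x])) \<le> length (xs @ [x]) * (k * sum w {..<l})"
        using Ns xs by (intro opt_blocks_crude[OF k w]) auto
      also have "\<dots> \<le> n * (k * sum w {..<l})"
        using xs(2) w by (intro mult_right_mono mult_nonneg_nonneg sum_nonneg) (auto simp: less_imp_le)
      finally show ?thesis using \<rho> by (simp add: mult_left_mono)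
    qed
    finally show False using R by simp
  qed
  have blocks: "\<exists>Ns. length Ns = length xs \<and> (\<forall>N\<in>set Ns. N \<le> R) \<and> st xs = s0 @ blocks Ns xs"
    if "rounds l k xs" "length xs \<le> n" for xs
    using that
  proof (induction xs rule: rev_induct)
    case (snoc x xs)
    then obtain Ns where Ns: "length Ns = length xs" "\<forall>N\<in>set Ns. N \<le> R" "st xs = s0 @ blocks Ns xs"
      by auto
    obtain N where "N < R" "cheap (st xs) x N"
      using ex_cheap[OF snoc.prems Ns(1,2)] Ns(3) by auto
    then have "(LEAST N. cheap (st xs) x N) \<le> R"
      by (meson Least_le less_imp_le order_trans)
    with Ns show ?case
      by (intro exI[of _ "Ns @ [LEAST N. cheap (st xs) x N]"]) (auto simp: st_snoc)
  qed (simp add: st_def)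
  show thesis
  proof
    show "st [] = s0" by (simp add: st_def)
    show "\<exists>N. st (xs @ [x]) = st xs @ replicate N x" for xs x
      using st_snoc by blast
    show "\<exists>Ns. length Ns = length xs \<and> st xs = s0 @ blocks Ns xs \<and> length (blocks Ns xs) \<le> n * R"
      if xs: "rounds l k xs" "length xs \<le> n" for xs
    proof -
      obtain Ns where "length Ns = length xs" "\<forall>N\<in>set Ns. N \<le> R" "st xs = s0 @ blocks Ns xs"
        using blocks[OF xs] by blast
      moreover from this have "length (blocks Ns xs) \<le> n * R"
        using length_blocks[of Ns xs R] mult_right_mono[OF xs(2), of R] by linarith
      ultimately show ?thesis by blast
    qed
    show "length (st (xs @ [x])) < L \<and> c (st (xs @ [x]) @ [x]) - c (st (xs @ [x])) \<le> \<delta>"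
      if xs: "rounds l k (xs @ [x])" "length (xs @ [x]) \<le> n" for xs x
    proof -
      obtain Ns where Ns: "length Ns = length xs" "\<forall>N\<in>set Ns. N \<le> R" "st xs = s0 @ blocks Ns xs"
        using blocks[of xs] xs by auto
      obtain N where N: "N < R" "cheap (st xs) x N"
        using ex_cheap[OF xs Ns(1,2)] Ns(3) by auto
      define N0 where "N0 = (LEAST N. cheap (st xs) x N)"
      \<comment> \<open>\<open>st\<close> stops just before the cheap scan; the strict inequality
        leaves room for that scan within length \<open>L\<close>.\<close>
      have N0: "cheap (st xs) x N0" "N0 < R"
        using N LeastI[of "cheap (st xs) x" N] Least_le[of "cheap (st xs) x" N]
        unfolding N0_def by linarith+
      have "Suc (length xs) * R \<le> n * R"
        using xs(2) by (intro mult_right_mono) auto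
      moreover have "length (blocks Ns xs) \<le> length xs * R"
        by (rule length_blocks[OF Ns(1,2)])
      moreover have "st (xs @ [x]) = st xs @ replicate N0 x"
        by (simp only: st_snoc N0_def)
      ultimately show ?thesis
        using N0 s0(2) Ns(3) by (simp add: cheap_def)
    qed
  qed
qed

text \<open>Unused cache is moved to a coordinate \<open>j\<close> of least weight, which at most doubles the movement.\<close>
definition fill :: "nat \<Rightarrow> nat \<Rightarrow> (nat \<Rightarrow> real) \<Rightarrow> nat \<Rightarrow> real" where
  "fill l j u i = (if i < l then if i = j then 1 - sum u ({..<l} - {j}) else u i else 0)"

text \<open>Coordinate \<open>j\<close> takes all the mass that the others leave, so it does not
  drop below \<open>u j\<close>. The value 0 from \<open>l\<close> on puts every coordinate into
  \<open>{0..1}\<close>, as the compactness argument requires.\<close>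

lemma fill:
  assumes j: "j < l" and u: "\<forall>i<l. 0 \<le> u i" "sum u {..<l} \<le> 1"
  shows "fill l j u i \<in> {0..1}" "fill l j u \<in> prob_simplex l" "i < l \<Longrightarrow> u i \<le> fill l j u i"
proof -
  have split: "sum f {..<l} = f j + sum f ({..<l} - {j})" for f :: "nat \<Rightarrow> real"
    using j by (simp add: sum.remove)
  have nonneg: "0 \<le> sum u ({..<l} - {j})" using u by (intro sum_nonneg) auto
  have le1: "u i \<le> 1" if "i < l" for i
    using member_le_sum[of i "{..<l}" u] u that by auto
  show le: "u i \<le> fill l j u i" if "i < l" for i
    using u(2) that by (auto simp: fill_def split[of u])
  have mem: "fill l j u i \<in> {0..1}" for i
    using le[of i] le1[of i] u nonneg by (auto simp: fill_def dest: order_trans)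
  then show "fill l j u i \<in> {0..1}" .
  have "sum (fill l j u) {..<l} = 1"
    unfolding split[of "fill l j u"] by (auto simp: fill_def j intro: sum.cong)
  with mem show "fill l j u \<in> prob_simplex l"
    by (auto simp: prob_simplex_def)
qed

text \<open>Coordinate \<open>j\<close> changes by at most the total change of the others, and each
  of these has at least the weight \<open>w j\<close>.\<close>

lemma fill_movement:
  assumes j: "j < l" and w: "\<forall>i<l. w j \<le> w i" "0 \<le> w j"
  shows "(\<Sum>i<l. w i * \<bar>fill l j u i - fill l j v i\<bar>) \<le> 2 * (\<Sum>i<l. w i * \<bar>u i - v i\<bar>)"
proof -
  let ?I = "{..<l} - {j}"
  have split: "sum f {..<l} = f j + sum f ?I" for f :: "nat \<Rightarrow> real"
    using j by (simp add: sum.remove)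
  have "\<bar>fill l j u j - fill l j v j\<bar> = \<bar>\<Sum>i\<in>?I. v i - u i\<bar>"
    using j by (simp add: fill_def sum_subtractf)
  also have "\<dots> \<le> (\<Sum>i\<in>?I. \<bar>v i - u i\<bar>)" by (rule sum_abs)
  finally have "w j * \<bar>fill l j u j - fill l j v j\<bar> \<le> w j * (\<Sum>i\<in>?I. \<bar>v i - u i\<bar>)"
    using w by (intro mult_left_mono)
  also have "\<dots> \<le> (\<Sum>i\<in>?I. w i * \<bar>u i - v i\<bar>)"
    unfolding sum_distrib_left using w by (intro sum_mono) (auto simp: abs_minus_commute intro!: mult_right_mono)
  finally have "(\<Sum>i<l. w i * \<bar>fill l j u i - fill l j v i\<bar>) \<le>
      (\<Sum>i\<in>?I. w i * \<bar>u i - v i\<bar>) + (\<Sum>i\<in>?I. w i * \<bar>fill l j u i - fill l j v i\<bar>)"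
    by (simp add: split[of "\<lambda>i. w i * \<bar>fill l j u i - fill l j v i\<bar>"])
  also have "(\<Sum>i\<in>?I. w i * \<bar>fill l j u i - fill l j v i\<bar>) = (\<Sum>i\<in>?I. w i * \<bar>u i - v i\<bar>)"
    by (intro sum.cong) (auto simp: fill_def)
  finally have "(\<Sum>i<l. w i * \<bar>fill l j u i - fill l j v i\<bar>) \<le> 2 * (\<Sum>i\<in>?I. w i * \<bar>u i - v i\<bar>)"
    by simp
  moreover have "(\<Sum>i<l. w i * \<bar>u i - v i\<bar>) = w j * \<bar>u j - v j\<bar> + (\<Sum>i\<in>?I. w i * \<bar>u i - v i\<bar>)"
    by (rule split)
  ultimately show ?thesis
    using mult_nonneg_nonneg[OF w(2) abs_ge_zero[of "u j - v j"]] by linarith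
qed

section \<open>The algorithm for bounded length and positive error\<close>

lemma approximate_algorithm:
  fixes w :: "nat \<Rightarrow> real" and \<rho> \<epsilon> :: real
  assumes wimp: "\<And>k. k \<ge> 1 \<Longrightarrow> wimp_competitive l w k \<rho>"
    and l: "l \<ge> 1" and w: "\<forall>i<l. w i > 0" and \<rho>: "\<rho> \<ge> 0" and \<epsilon>: "\<epsilon> > 0"
  shows "\<exists>X :: alloc_alg. (\<forall>h i. X h i \<in> {0..1}) \<and>
    (\<forall>\<sigma>. valid_alloc_seq l \<sigma> \<and> length \<sigma> \<le> n \<longrightarrow>
      (\<forall>t\<le>length \<sigma>. X (take t \<sigma>) \<in> prob_simplex l) \<and>
      (\<forall>t\<in>{1..length \<sigma>}. X (take t \<sigma>) (fst (\<sigma> ! (t - 1))) \<ge> snd (\<sigma> ! (t - 1)) - \<epsilon>) \<and>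
      (\<forall>x. feasible l \<sigma> x \<longrightarrow> movement l w (length \<sigma>) (\<lambda>t. X (take t \<sigma>)) \<le>
        4 * \<rho> * movement l w (length \<sigma>) x + (8 * \<rho> * sum w {..<l} + 2 * sum w {..<l} + 4)))"
proof -
  let ?W = "sum w {..<l}"
  obtain j where j: "j < l" "\<forall>i<l. w j \<le> w i"
    using ex_min_if_finite[of "w ` {..<l}"] l by (auto simp: not_less lessThan_empty_iff)
  \<comment> \<open>\<open>n \<le> k\<close> bounds the rounding cost of the offline allocation,
    divided by \<open>k\<close>, by \<open>?W\<close>. \<open>2 / \<epsilon> \<le> k\<close> keeps
    the rounding of thresholds within \<open>\<epsilon> / 2\<close>; the other half of
    \<open>\<epsilon>\<close> goes into \<open>\<delta>\<close>.\<close>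
  define k where "k = max n (nat \<lceil>2 / \<epsilon>\<rceil>) + 1"
  have k: "k \<ge> 1" "n \<le> k" by (auto simp: k_def)
  have "2 / \<epsilon> \<le> k" unfolding k_def by linarith
  then have k\<epsilon>: "1 / k \<le> \<epsilon> / 2" using \<epsilon> k by (simp add: field_simps)
  define \<delta> where "\<delta> = \<epsilon> / 2 * w j"
  have \<delta>: "\<delta> > 0" using \<epsilon> w j by (simp add: \<delta>_def)
  define R where "R = nat \<lceil>(\<rho> * (n * (k * ?W)) + 1) / \<delta>\<rceil> + 1"
  have "(\<rho> * (n * (k * ?W)) + 1) / \<delta> < R" unfolding R_def by linarith
  then have R: "\<rho> * (n * (k * ?W)) + 1 < R * \<delta>" using \<delta> by (simp add: field_simps)
  obtain b where b: "\<And>L. \<exists>y c. fractional_play l w k L y c \<and> c [] = 0 \<and>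
      (\<forall>s. rounds l k s \<and> length s \<le> L \<longrightarrow> c s \<le> \<rho> * opt w k s + b)"
    using wimp_fractional_play[OF wimp[OF k(1)] k(1) w \<rho>] by blast
  define L where "L = (nat \<lceil>b\<rceil> + 2) * (n * R)"
  obtain y c where play: "fractional_play l w k L y c" and c: "c [] = 0"
      "\<And>s. rounds l k s \<Longrightarrow> length s \<le> L \<Longrightarrow> c s \<le> \<rho> * opt w k s + b"
    using b[of L] by blast
  obtain s0 where s0: "rounds l k s0" "length s0 + n * R \<le> L"
      "\<And>s. rounds l k s \<Longrightarrow> length s \<le> n * R \<Longrightarrow> c (s0 @ s) - c s0 \<le> \<rho> * opt w k s + 1"
    using saturated_start[where c = c and k = k and \<rho> = \<rho> and l = l and b = b and n = "n * R" and w = w]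
      c k(1) \<rho> unfolding L_def by blast
  obtain st where st: "st [] = s0" "\<And>xs x. \<exists>N. st (xs @ [x]) = st xs @ replicate N x"
    and st_blocks: "\<And>xs. rounds l k xs \<Longrightarrow> length xs \<le> n \<Longrightarrow>
      \<exists>Ns. length Ns = length xs \<and> st xs = s0 @ blocks Ns xs \<and> length (blocks Ns xs) \<le> n * R"
    and st_cheap: "\<And>xs x. rounds l k (xs @ [x]) \<Longrightarrow> length (xs @ [x]) \<le> n \<Longrightarrow>
      length (st (xs @ [x])) < L \<and> c (st (xs @ [x]) @ [x]) - c (st (xs @ [x])) \<le> \<delta>"
    using repeat_until_cheap[OF play w k(1) \<rho> s0 R] by blast
  define S where "S h = st (map (discretize k) h)" for h
  \<comment> \<open>The zero function on all other histories keeps the values in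
    \<open>{0..1}\<close>.\<close>
  define X :: alloc_alg where
    "X h = (if valid_alloc_seq l h \<and> length h \<le> n then fill l j (y (S h)) else (\<lambda>i. 0))" for h
  have S: "rounds l k (S h)" "length (S h) \<le> L" if h: "valid_alloc_seq l h" "length h \<le> n" for h
  proof -
    have h': "rounds l k (map (discretize k) h)" "length (map (discretize k) h) \<le> n"
      using h rounds_discretize by auto
    obtain Ns where "S h = s0 @ blocks Ns (map (discretize k) h)"
        "length (blocks Ns (map (discretize k) h)) \<le> n * R"
      unfolding S_def using st_blocks[OF h'] by blast
    then show "rounds l k (S h)" "length (S h) \<le> L"
      using s0 rounds_blocks[OF h'(1)] by auto
  qed
  have y: "\<forall>i<l. 0 \<le> y (S h) i" "sum (y (S h)) {..<l} \<le> 1" if "valid_alloc_seq l h" "length h \<le> n" for h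
    using play S[OF that] unfolding fractional_play_def by blast+
  have main: "(\<forall>t\<le>length \<sigma>. X (take t \<sigma>) \<in> prob_simplex l) \<and>
      (\<forall>t\<in>{1..length \<sigma>}. X (take t \<sigma>) (fst (\<sigma> ! (t - 1))) \<ge> snd (\<sigma> ! (t - 1)) - \<epsilon>) \<and>
      (\<forall>x. feasible l \<sigma> x \<longrightarrow> movement l w (length \<sigma>) (\<lambda>t. X (take t \<sigma>)) \<le>
        4 * \<rho> * movement l w (length \<sigma>) x + (8 * \<rho> * ?W + 2 * ?W + 4))"
    if \<sigma>: "valid_alloc_seq l \<sigma>" "length \<sigma> \<le> n" for \<sigma>
  proof (intro conjI allI impI ballI)
    have tk: "valid_alloc_seq l (take t \<sigma>)" "length (take t \<sigma>) \<le> n" for t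
      using \<sigma> by (auto simp: valid_alloc_seq_def dest: in_set_takeD)
    have X: "X (take t \<sigma>) = fill l j (y (S (take t \<sigma>)))" for t
      unfolding X_def using tk[of t] by simp
    note y = y[OF tk]
    show "X (take t \<sigma>) \<in> prob_simplex l" for t
      unfolding X by (rule fill(2)[OF j(1) y])
    show "X (take t \<sigma>) (fst (\<sigma> ! (t - 1))) \<ge> snd (\<sigma> ! (t - 1)) - \<epsilon>" if t: "t \<in> {1..length \<sigma>}" for t
    proof -
      obtain r a where ra: "\<sigma> ! (t - 1) = (r, a)" by (cases "\<sigma> ! (t - 1)")
      have "\<sigma> ! (t - 1) \<in> set \<sigma>" using t by (intro nth_mem) auto
      then have r: "r < l" "0 \<le> a" using \<sigma> ra by (auto simp: valid_alloc_seq_def)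
      define m where "m = nat \<lfloor>k * a\<rfloor>"
      have split: "take t \<sigma> = take (t - 1) \<sigma> @ [(r, a)]"
      proof -
        have "t - 1 < length \<sigma>" "Suc (t - 1) = t" using t by auto
        with take_Suc_conv_app_nth[of "t - 1" \<sigma>] ra show ?thesis by metis
      qed
      let ?xs = "map (discretize k) (take (t - 1) \<sigma>)"
      have St: "S (take t \<sigma>) = st (?xs @ [(r, m)])"
        unfolding split S_def by (simp add: discretize_def m_def)
      have xs: "rounds l k (?xs @ [(r, m)])" "length (?xs @ [(r, m)]) \<le> n"
        using rounds_discretize[OF tk(1), of k t] tk(2)[of t] unfolding split
        by (simp_all add: discretize_def m_def)
      note cheap = st_cheap[OF xs, folded St]
      have m: "m \<le> k" "real m \<ge> k * a - 1"
        using xs(1) by (simp_all add: rounds_def m_def, linarith)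
      let ?\<Delta> = "c (S (take t \<sigma>) @ [(r, m)]) - c (S (take t \<sigma>))"
      have valid: "rounds l k (S (take t \<sigma>) @ [(r, m)])"
        using S[OF tk] m(1) r by (simp add: rounds_def)
      have "w r * m \<le> w r * (k * y (S (take t \<sigma>)) r) + m * ?\<Delta>"
        using play_step(2)[OF play valid] cheap by blast
      \<comment> \<open>One more scan would be cheap, so by the choice of \<open>\<delta>\<close>
        the missing fraction is at most \<open>\<epsilon> / 2\<close>, for every class because
        \<open>w j\<close> is the least weight.\<close>
      also have "m * ?\<Delta> \<le> m * \<delta>" using cheap by (intro mult_left_mono) auto
      also have "\<dots> \<le> k * \<delta>" using m \<delta> by (intro mult_right_mono) auto
      also have "\<dots> \<le> k * (\<epsilon> / 2 * w r)"
        unfolding \<delta>_def using j r \<epsilon> by (intro mult_left_mono) auto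
      finally have "w r * m \<le> w r * (k * y (S (take t \<sigma>)) r + k * (\<epsilon> / 2))"
        by (simp add: algebra_simps)
      then have "m \<le> k * y (S (take t \<sigma>)) r + k * (\<epsilon> / 2)"
        using w r by simp
      with m have "k * a \<le> k * y (S (take t \<sigma>)) r + k * (\<epsilon> / 2) + k * (1 / k)"
        using k by simp
      also have "\<dots> \<le> k * (y (S (take t \<sigma>)) r + \<epsilon>)"
        using mult_left_mono[OF k\<epsilon>, of k] by (simp add: algebra_simps)
      finally have "a \<le> y (S (take t \<sigma>)) r + \<epsilon>" using k by simp
      also have "y (S (take t \<sigma>)) r \<le> X (take t \<sigma>) r"
        unfolding X by (rule fill(3)[OF j(1) y r(1)])
      finally show ?thesis unfolding ra by simp
    qed
    fix x assume x: "feasible l \<sigma> x"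
    define Y where "Y t = y (S (take t \<sigma>))" for t
    define C where "C t = c (S (take t \<sigma>))" for t
    have W: "0 \<le> ?W" using w by (intro sum_nonneg) (auto simp: less_imp_le)
    \<comment> \<open>The cost controls increases only. Since
      \<open>\<bar>d\<bar> + d = 2 * max 0 d\<close>, the weighted sum of \<open>Y\<close> is a
      potential that pays for decreases at the price of a factor 2.\<close>
    have increments: "movement l w T Y + (\<Sum>i<l. w i * Y T i) \<le> 2 * ((C T - C 0) / k) + (\<Sum>i<l. w i * Y 0 i)"
      if "T \<le> length \<sigma>" for T
      using that
    proof (induction T)
      case (Suc T)
      have "take (Suc T) \<sigma> = take T \<sigma> @ [\<sigma> ! T]"
        using Suc.prems by (simp add: take_Suc_conv_app_nth)
      then obtain N where N: "S (take (Suc T) \<sigma>) = S (take T \<sigma>) @ replicate N (discretize k (\<sigma> ! T))"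
        unfolding S_def using st(2) by (metis list.simps(8,9) map_append)
      have "k * (\<Sum>i<l. w i * max 0 (Y (Suc T) i - Y T i)) \<le> C (Suc T) - C T"
        unfolding Y_def C_def N using S[OF tk[of "Suc T"]] unfolding N by (intro play_increment[OF play w])
      then have "(\<Sum>i<l. w i * max 0 (Y (Suc T) i - Y T i)) \<le> (C (Suc T) - C T) / k"
        using k by (simp add: field_simps)
      moreover have "(\<Sum>i<l. w i * \<bar>Y (Suc T) i - Y T i\<bar>) + (\<Sum>i<l. w i * Y (Suc T) i) - (\<Sum>i<l. w i * Y T i) =
          2 * (\<Sum>i<l. w i * max 0 (Y (Suc T) i - Y T i))"
        unfolding sum_distrib_left sum.distrib[symmetric] sum_subtractf[symmetric]
        by (intro sum.cong) (auto simp: max_def abs_if algebra_simps)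
      moreover have "movement l w (Suc T) Y = movement l w T Y + (\<Sum>i<l. w i * \<bar>Y (Suc T) i - Y T i\<bar>)"
        by (simp add: movement_def)
      moreover have "2 * ((C (Suc T) - C 0) / k) = 2 * ((C (Suc T) - C T) / k) + 2 * ((C T - C 0) / k)"
        by (simp add: diff_divide_distrib)
      ultimately show ?case using Suc by linarith
    qed (simp add: movement_def)
    have "C (length \<sigma>) - C 0 \<le> k * (\<rho> * (movement l w (length \<sigma>) x + 2 * ?W) + 1)"
    proof -
      obtain Ns where Ns: "length Ns = length (map (discretize k) \<sigma>)"
          "S \<sigma> = s0 @ blocks Ns (map (discretize k) \<sigma>)"
          "length (blocks Ns (map (discretize k) \<sigma>)) \<le> n * R"
        unfolding S_def using st_blocks[of "map (discretize k) \<sigma>"] rounds_discretize \<sigma> by auto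
      \<comment> \<open>Time 0 corresponds to the history \<open>s0\<close>, so the cost of reaching
        it is not charged.\<close>
      have "C (length \<sigma>) - C 0 = c (s0 @ blocks Ns (map (discretize k) \<sigma>)) - c s0"
        unfolding C_def by (simp add: Ns(2)) (simp add: S_def st(1))
      also have "\<dots> \<le> \<rho> * opt w k (blocks Ns (map (discretize k) \<sigma>)) + 1"
        using Ns \<sigma> by (intro s0(3) rounds_blocks rounds_discretize)
      also have "\<dots> \<le> \<rho> * (k * movement l w (length \<sigma>) x + (length \<sigma> + k) * ?W) + 1"
        using opt_le_movement[OF k(1) w \<sigma>(1) x, of Ns] Ns(1) \<rho> by (simp add: mult_left_mono)
      also have "\<dots> \<le> \<rho> * (k * movement l w (length \<sigma>) x + (k + k) * ?W) + k * 1"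
        using \<rho> W \<sigma>(2) k by (intro add_mono mult_left_mono mult_right_mono) auto
      finally show ?thesis by (simp add: algebra_simps)
    qed
    then have "(C (length \<sigma>) - C 0) / k \<le> \<rho> * (movement l w (length \<sigma>) x + 2 * ?W) + 1"
      using k by (simp add: field_simps)
    moreover have "(\<Sum>i<l. w i * Y 0 i) \<le> ?W"
    proof (intro sum_mono mult_left_le)
      fix i assume i: "i \<in> {..<l}"
      then have "Y 0 i \<le> sum (Y 0) {..<l}"
        unfolding Y_def using y[of 0] by (intro member_le_sum) auto
      also have "\<dots> \<le> 1" unfolding Y_def by (rule y(2))
      finally show "Y 0 i \<le> 1" .
    qed (use w in \<open>auto simp: less_imp_le\<close>)
    moreover have "0 \<le> (\<Sum>i<l. w i * Y (length \<sigma>) i)"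
      unfolding Y_def using w y(1)[of "length \<sigma>"] by (intro sum_nonneg mult_nonneg_nonneg) (auto simp: less_imp_le)
    moreover have "movement l w (length \<sigma>) (\<lambda>t. X (take t \<sigma>)) \<le> 2 * movement l w (length \<sigma>) Y"
      unfolding movement_def X Y_def sum_distrib_left[of 2 _ "{1..length \<sigma>}"]
      using j w by (intro sum_mono fill_movement) (auto simp: less_imp_le)
    \<comment> \<open>Here \<open>d\<close> is the scaled cost with bound \<open>e\<close>,
      \<open>q\<close> and \<open>p\<close> are the potential at the start and the end,
      \<open>v\<close> bounds \<open>q\<close>, and \<open>b\<close> and \<open>a\<close> are the
      movements before and after filling. The outer 2 comes from filling, the inner one from
      decreases.\<close>
    moreover have "a \<le> 2 * (2 * e + v)"
      if "d \<le> e" "q \<le> v" "0 \<le> p" "a \<le> 2 * b" "b + p \<le> 2 * d + q" for a b d e p q v :: real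
      using that by argo
    ultimately have "movement l w (length \<sigma>) (\<lambda>t. X (take t \<sigma>)) \<le>
        2 * (2 * (\<rho> * (movement l w (length \<sigma>) x + 2 * ?W) + 1) + ?W)"
      using increments[OF order_refl] by blast
    also have "\<dots> = 4 * \<rho> * movement l w (length \<sigma>) x + (8 * \<rho> * ?W + 2 * ?W + 4)"
      by (simp add: algebra_simps)
    finally show "movement l w (length \<sigma>) (\<lambda>t. X (take t \<sigma>)) \<le>
        4 * \<rho> * movement l w (length \<sigma>) x + (8 * \<rho> * ?W + 2 * ?W + 4)" .
  qed
  have "X h i \<in> {0..1}" for h i
    using fill(1)[OF j(1) y] by (auto simp: X_def)
  with main show ?thesis by (intro exI[of _ X]) blast
qed

section \<open>Passage to an exact algorithm by compactness\<close>

lemma limit_algorithm: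
  fixes w :: "nat \<Rightarrow> real" and \<alpha> \<beta> :: real
  assumes approx: "\<And>n \<epsilon>. \<epsilon> > 0 \<Longrightarrow> \<exists>X :: alloc_alg. (\<forall>h i. X h i \<in> {0..1}) \<and>
    (\<forall>\<sigma>. valid_alloc_seq l \<sigma> \<and> length \<sigma> \<le> n \<longrightarrow>
      (\<forall>t\<le>length \<sigma>. X (take t \<sigma>) \<in> prob_simplex l) \<and>
      (\<forall>t\<in>{1..length \<sigma>}. X (take t \<sigma>) (fst (\<sigma> ! (t - 1))) \<ge> snd (\<sigma> ! (t - 1)) - \<epsilon>) \<and>
      (\<forall>x. feasible l \<sigma> x \<longrightarrow> movement l w (length \<sigma>) (\<lambda>t. X (take t \<sigma>)) \<le>
        \<alpha> * movement l w (length \<sigma>) x + \<beta>))"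
  shows "\<exists>X :: alloc_alg. \<forall>\<sigma>. valid_alloc_seq l \<sigma> \<longrightarrow> feasible l \<sigma> (\<lambda>t. X (take t \<sigma>)) \<and>
    (\<forall>x. feasible l \<sigma> x \<longrightarrow> movement l w (length \<sigma>) (\<lambda>t. X (take t \<sigma>)) \<le>
        \<alpha> * movement l w (length \<sigma>) x + \<beta>)"
proof -
  \<comment> \<open>Each condition involves finitely many coordinates of \<open>X\<close>, so it is
    closed under pointwise convergence. \<open>\<alpha>\<close> and \<open>\<beta>\<close> are the
    same for all lengths and errors and thus survive the limit.\<close>
  define good :: "(nat \<times> real) list \<Rightarrow> real \<Rightarrow> alloc_alg set" where
    "good \<sigma> \<epsilon> = {X. (\<forall>t\<le>length \<sigma>. X (take t \<sigma>) \<in> prob_simplex l) \<and>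
      (\<forall>t\<in>{1..length \<sigma>}. X (take t \<sigma>) (fst (\<sigma> ! (t - 1))) \<ge> snd (\<sigma> ! (t - 1)) - \<epsilon>) \<and>
      (\<forall>x. feasible l \<sigma> x \<longrightarrow> movement l w (length \<sigma>) (\<lambda>t. X (take t \<sigma>)) \<le>
        \<alpha> * movement l w (length \<sigma>) x + \<beta>)}" for \<sigma> \<epsilon>
  define cube :: "alloc_alg set" where "cube = PiE UNIV (\<lambda>h. PiE UNIV (\<lambda>i. {0..1}))"
  have "compact (PiE UNIV (\<lambda>i. {0..1}) :: (nat \<Rightarrow> real) set)"
    unfolding compactin_euclidean_iff[symmetric] euclidean_product_topology[symmetric]
    by (auto simp: compactin_PiE)
  then have "compact cube"
    unfolding cube_def compactin_euclidean_iff[symmetric]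
    by (subst euclidean_product_topology[symmetric]) (auto simp: compactin_PiE)
  have coordinate: "continuous_on UNIV (\<lambda>X :: alloc_alg. X h i)" for h i
    by (rule continuous_on_product_then_coordinatewise[OF continuous_on_product_coordinates])
  have closed: "closed (good \<sigma> \<epsilon>)" for \<sigma> \<epsilon>
  proof -
    have eq: "good \<sigma> \<epsilon> =
        (\<Inter>t\<in>{..length \<sigma>}. (\<Inter>i\<in>{..<l}. {X. 0 \<le> X (take t \<sigma>) i}) \<inter> {X. (\<Sum>i<l. X (take t \<sigma>) i) = 1}) \<inter>
        (\<Inter>t\<in>{1..length \<sigma>}. {X. snd (\<sigma> ! (t - 1)) - \<epsilon> \<le> X (take t \<sigma>) (fst (\<sigma> ! (t - 1)))}) \<inter>
        (\<Inter>x\<in>Collect (feasible l \<sigma>). {X. movement l w (length \<sigma>) (\<lambda>t. X (take t \<sigma>)) \<le>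
          \<alpha> * movement l w (length \<sigma>) x + \<beta>})"
      by (auto simp: good_def prob_simplex_def)
    have "closed {X :: alloc_alg. 0 \<le> X h i}" for h i
      by (intro closed_Collect_le continuous_on_const coordinate)
    moreover have "closed {X :: alloc_alg. (\<Sum>i<l. X h i) = 1}" for h
      by (intro closed_Collect_eq continuous_on_sum continuous_on_const coordinate)
    moreover have "closed {X :: alloc_alg. z \<le> X h i}" for z h i
      by (intro closed_Collect_le continuous_on_const coordinate)
    moreover have "continuous_on UNIV (\<lambda>X :: alloc_alg. movement l w m (\<lambda>t. X (h t)))" for m h
      unfolding movement_def
      by (intro continuous_on_sum continuous_on_mult continuous_on_const continuous_on_rabs
          continuous_on_diff coordinate)
    then have "closed {X :: alloc_alg. movement l w m (\<lambda>t. X (h t)) \<le> z}" for m h z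
      by (intro closed_Collect_le continuous_on_const)
    ultimately show ?thesis
      unfolding eq by (intro closed_Int closed_INT ballI)
  qed
  define I where "I = {(\<sigma>, \<epsilon>). valid_alloc_seq l \<sigma> \<and> \<epsilon> > (0::real)}"
  have "cube \<inter> (\<Inter>(\<sigma>, \<epsilon>)\<in>I. good \<sigma> \<epsilon>) \<noteq> {}"
  proof (rule compact_imp_fip_image)
    fix J assume J: "finite J" "J \<subseteq> I"
    \<comment> \<open>One algorithm for the greatest length and the least error meets all conditions
      in \<open>J\<close>, because \<open>good\<close> grows with the error. The inserted 0 and 1
      cover an empty \<open>J\<close>.\<close>
    define n where "n = Max (insert 0 ((length \<circ> fst) ` J))"
    define \<epsilon> where "\<epsilon> = Min (insert 1 (snd ` J))"
    have "\<epsilon> > 0" using J by (auto simp: \<epsilon>_def I_def)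
    from approx[OF this, of n] obtain X where X: "\<And>h i. X h i \<in> {0..1}"
      "\<And>\<sigma>. valid_alloc_seq l \<sigma> \<Longrightarrow> length \<sigma> \<le> n \<Longrightarrow> X \<in> good \<sigma> \<epsilon>"
      unfolding good_def by blast
    have "X \<in> good \<sigma> e" if "(\<sigma>, e) \<in> J" for \<sigma> e
    proof -
      have "length \<sigma> \<le> n" unfolding n_def using J that by (intro Max_ge) force+
      moreover have "valid_alloc_seq l \<sigma>" using J that by (auto simp: I_def)
      ultimately have "X \<in> good \<sigma> \<epsilon>" by (intro X(2))
      moreover have "\<epsilon> \<le> e" unfolding \<epsilon>_def using J that by (intro Min_le) force+
      ultimately show ?thesis unfolding good_def by fastforce
    qed
    moreover have "X \<in> cube" using X(1) by (auto simp: cube_def)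
    ultimately show "cube \<inter> (\<Inter>(\<sigma>, \<epsilon>)\<in>J. good \<sigma> \<epsilon>) \<noteq> {}" by auto
  qed (use \<open>compact cube\<close> closed in auto)
  then obtain X where X: "\<And>\<sigma> \<epsilon>. valid_alloc_seq l \<sigma> \<Longrightarrow> \<epsilon> > 0 \<Longrightarrow> X \<in> good \<sigma> \<epsilon>"
    by (auto simp: I_def)
  have "feasible l \<sigma> (\<lambda>t. X (take t \<sigma>))" if "valid_alloc_seq l \<sigma>" for \<sigma>
  proof -
    have "snd (\<sigma> ! (t - 1)) \<le> X (take t \<sigma>) (fst (\<sigma> ! (t - 1)))" if "t \<in> {1..length \<sigma>}" for t
    proof (rule field_le_epsilon)
      fix e :: real assume "0 < e"
      from X[OF \<open>valid_alloc_seq l \<sigma>\<close> this] that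
      have "snd (\<sigma> ! (t - 1)) - e \<le> X (take t \<sigma>) (fst (\<sigma> ! (t - 1)))"
        unfolding good_def by blast
      then show "snd (\<sigma> ! (t - 1)) \<le> X (take t \<sigma>) (fst (\<sigma> ! (t - 1))) + e" by simp
    qed
    with X[OF that zero_less_one] show ?thesis unfolding good_def feasible_def by blast
  qed
  with X[OF _ zero_less_one] show ?thesis unfolding good_def by blast
qed

section \<open>From movement bounds to the competitive ratio\<close>

lemma wimp_competitive_max_0: "wimp_competitive l w k (max 0 \<rho>) = wimp_competitive l w k \<rho>"
  by (simp add: wimp_competitive_def ennreal_max_0)

theorem theorem3:
  shows "\<exists>C::real. C > 0 \<and>
    (\<forall>(l::nat) (w::nat \<Rightarrow> real) (\<rho>::real).
       l \<ge> 1 \<longrightarrow> (\<forall>i<l. w i > 0) \<longrightarrow>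
       (\<forall>k::nat. k \<ge> 1 \<longrightarrow> wimp_competitive l w k \<rho>) \<longrightarrow>
       (\<exists>X::alloc_alg. alloc_competitive l w X (C * \<rho>)))"
proof (intro exI[of _ "4 :: real"] conjI allI impI)
  fix l :: nat and w :: "nat \<Rightarrow> real" and \<rho> :: real
  assume l: "l \<ge> 1" and w: "\<forall>i<l. w i > 0" and wimp: "\<forall>k\<ge>1. wimp_competitive l w k \<rho>"
  \<comment> \<open>Ratios enter through \<open>ennreal\<close>, which sends negative numbers to
    0.\<close>
  define \<rho>' where "\<rho>' = max 0 \<rho>"
  have \<rho>': "\<rho>' \<ge> 0" "ennreal (4 * \<rho>) = ennreal (4 * \<rho>')"
    by (auto simp: \<rho>'_def max_def ennreal_neg)
  define \<beta> where "\<beta> = 8 * \<rho>' * sum w {..<l} + 2 * sum w {..<l} + 4"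
  have \<beta>: "\<beta> \<ge> 0"
    unfolding \<beta>_def using \<rho>' w by (intro add_nonneg_nonneg mult_nonneg_nonneg sum_nonneg) (auto simp: less_imp_le)
  have "wimp_competitive l w k \<rho>'" if "k \<ge> 1" for k
    using wimp that by (simp add: \<rho>'_def wimp_competitive_max_0)
  then obtain X :: alloc_alg where X: "\<And>\<sigma>. valid_alloc_seq l \<sigma> \<Longrightarrow> feasible l \<sigma> (\<lambda>t. X (take t \<sigma>))"
    "\<And>\<sigma> x. valid_alloc_seq l \<sigma> \<Longrightarrow> feasible l \<sigma> x \<Longrightarrow>
      movement l w (length \<sigma>) (\<lambda>t. X (take t \<sigma>)) \<le> 4 * \<rho>' * movement l w (length \<sigma>) x + \<beta>"
    using limit_algorithm[OF approximate_algorithm[OF _ l w \<rho>'(1)]] unfolding \<beta>_def by blast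
  have "alloc_cost l w \<sigma> (\<lambda>t. X (take t \<sigma>)) \<le> ennreal (4 * \<rho>) * alloc_opt l w \<sigma> + ennreal (4 * \<rho>' + \<beta>)"
    if \<sigma>: "valid_alloc_seq l \<sigma>" for \<sigma>
  proof -
    have "alloc_opt l w \<sigma> \<le> alloc_cost l w \<sigma> (\<lambda>t. X (take t \<sigma>))"
      unfolding alloc_opt_def by (intro INF_lower) auto
    also have "\<dots> < \<infinity>" using X(1)[OF \<sigma>] by (simp add: alloc_cost_eq)
    finally have "alloc_opt l w \<sigma> \<noteq> \<infinity>" by simp
    \<comment> \<open>The comparison uses an offline solution within 1 of the infimum; this excess
      is the summand \<open>4 * \<rho>'\<close> of the additive constant.\<close>
    from INF_approx_ennreal[OF zero_less_one alloc_opt_def this]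
    obtain x where x: "alloc_cost l w \<sigma> x < alloc_opt l w \<sigma> + ennreal 1" by auto
    then have feas: "feasible l \<sigma> x" by (auto simp: alloc_cost_eq split: if_splits)
    have nonneg: "0 \<le> movement l w (length \<sigma>) x"
      unfolding movement_def using w by (intro sum_nonneg mult_nonneg_nonneg) (auto simp: less_imp_le)
    have "alloc_cost l w \<sigma> (\<lambda>t. X (take t \<sigma>)) \<le> ennreal (4 * \<rho>' * movement l w (length \<sigma>) x + \<beta>)"
      using X(1)[OF \<sigma>] X(2)[OF \<sigma> feas] by (simp add: alloc_cost_eq ennreal_leI)
    also have "\<dots> = ennreal (4 * \<rho>') * alloc_cost l w \<sigma> x + ennreal \<beta>"
      using \<rho>' \<beta> nonneg feas by (simp add: alloc_cost_eq ennreal_mult ennreal_plus)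
    also have "\<dots> \<le> ennreal (4 * \<rho>') * (alloc_opt l w \<sigma> + ennreal 1) + ennreal \<beta>"
      using x by (intro add_mono mult_left_mono) auto
    also have "\<dots> = ennreal (4 * \<rho>) * alloc_opt l w \<sigma> + ennreal (4 * \<rho>' + \<beta>)"
      using \<rho>' \<beta> by (simp add: distrib_left ennreal_plus add.assoc)
    finally show ?thesis .
  qed
  then show "\<exists>X. alloc_competitive l w X (4 * \<rho>)"
    unfolding alloc_competitive_def by blast
qed simp

end
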